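(* Let $X$ be a topological space such that $X\times X$ is a simplicial complex, $(X\times X,\Delta(X))$ is an NDR pair, and there exists a fibrewise pointed categorical neighbourhood of the diagonal $\Delta(X)$ in $X\times X$. Then the monoidal topological complexity $\mathrm{TC}^M(X)$ is the least integer $n$ such that the map $$1\ltimes p_n\colon X\ltimes G_n(X)\to X\ltimes X$$ admits a section (in the category of fibrewise pointed spaces over $X$).
   Context: A fibrewise pointed space over $B$ is a space $E$ with maps $p\colon E\to B$ (projection) and $s\colon B\to E$ (section) with $p\circ s=1_B$. A fibrewise pointed map is a continuous map commuting with projections and sections; a fibrewise pointed homotopy is a homotopy through such maps. $X\ltimes X$ denotes the fibrewise pointed space over $X$ with total space $X\times X$, projection $\mathrm{pr}_1$ (first coordinate) and section the diagonal $\Delta\colon X\to X\times X$. An open set $U\subseteq X\times X$ is fibrewise pointed categorical if $\Delta(X)\subseteq U$ and there is a homotopy $H\colon U\times I\to X\times X$ of the form $H(x,y,t)=(x,h(x,y,t))$, starting at the inclusion, stationary on $\Delta(X)$, with $H(U\times\{1\})\subseteq\Delta(X)$. The monoidal topological complexity $\mathrm{TC}^M(X)$ is the least integer $n$ such that $X\times X$ can be covered by $n$ fibrewise pointed categorical open sets ($\infty$ if there is no such $n$). The sum (fibrewise join) over $B$ of fibrations $p_1\colon E_1\to B$ and $p_2\colon E_2\to B$ is $E=\{(e_1,t_1,e_2,t_2)\in E_1\times I\times E_2\times I \mid p_1(e_1)=p_2(e_2),\ \max\{t_1,t_2\}=1\}/\sim$, where $(e_1,0,e_2,1)\sim(e_1',0,e_2,1)$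 and $(e_1,1,e_2,0)\sim(e_1,1,e_2',0)$, with projection $(e_1,t_1,e_2,t_2)\mapsto p_1(e_1)=p_2(e_2)$. Let $\mathrm{ev}_{0,1}\colon X^I\to X\times X$, $\alpha\mapsto(\alpha(0),\alpha(1))$. The space $X\ltimes G_n(X)$ is the $n$-fold fibrewise join over $X\times X$ of $\mathrm{ev}_{0,1}$ with itself; its points are classes $[\alpha_1,t_1,\dots,\alpha_n,t_n]$ with $\alpha_i\in X^I$ all having the same pair of end-points, $t_i\in I$, $\max_i t_i=1$, where $\alpha_i$ is disregarded if $t_i=0$. The map $1\ltimes p_n\colon X\ltimes G_n(X)\to X\times X$ is the join projection (common pair of end-points). $X\ltimes G_n(X)$ is a fibrewise pointed space over $X$ with projection $\mathrm{pr}_1\circ(1\ltimes p_n)$ and section $\widehat G_n$ sending $x$ to the point determined by the constant path $c_x$, i.e. $[c_x,1,\dots,c_x,1]$. A section of $1\ltimes p_n$ means a fibrewise pointed map $s\colon X\ltimes X\to X\ltimes G_n(X)$ (so in particular $s\circ\Delta=\widehat G_n$) with $(1\ltimes p_n)\circ s=1$. *)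

theory Defs
  imports "HOL-Analysis.Analysis" "HOL-Library.Extended_Nat"
begin

section \<open>Point-set preliminaries\<close>

abbreviation unit_interval :: "real topology"
  where "unit_interval \<equiv> top_of_set {0..1}"

abbreviation square :: "'a topology \<Rightarrow> ('a \<times> 'a) topology"
  where "square X \<equiv> prod_topology X X"

abbreviation diag :: "'a \<Rightarrow> 'a \<times> 'a"
  where "diag x \<equiv> (x, x)"

definition quotient_topology :: "'a topology \<Rightarrow> ('a \<Rightarrow> 'b) \<Rightarrow> 'b topology"
  where "quotient_topology Y q =
    topology (\<lambda>U. U \<subseteq> q ` topspace Y \<and> openin Y {x \<in> topspace Y. q x \<in> U})"

lemma openin_quotient_topology:
  "openin (quotient_topology Y q) U \<longleftrightarrow>
     U \<subseteq> q ` topspace Y \<and> openin Y {x \<in> topspace Y. q x \<in> U}"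
proof -
  let ?L = "\<lambda>U. U \<subseteq> q ` topspace Y \<and> openin Y {x \<in> topspace Y. q x \<in> U}"
  have "istopology ?L"
    unfolding istopology_def
  proof (intro conjI allI impI)
    fix S T assume "?L S" "?L T"
    moreover have "{x \<in> topspace Y. q x \<in> S \<inter> T} =
        {x \<in> topspace Y. q x \<in> S} \<inter> {x \<in> topspace Y. q x \<in> T}"
      by blast
    ultimately show "S \<inter> T \<subseteq> q ` topspace Y"
      and "openin Y {x \<in> topspace Y. q x \<in> S \<inter> T}"
      by auto
  next
    fix \<K> assume *: "\<forall>K\<in>\<K>. ?L K"
    then show "\<Union>\<K> \<subseteq> q ` topspace Y" by blast
    have "{x \<in> topspace Y. q x \<in> \<Union>\<K>} = (\<Union>K\<in>\<K>. {x \<in> topspace Y. q x \<in> K})"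
      by blast
    then show "openin Y {x \<in> topspace Y. q x \<in> \<Union>\<K>}"
      using * by auto
  qed
  then show ?thesis
    by (simp add: quotient_topology_def topology_inverse')
qed

lemma topspace_quotient_topology [simp]:
  "topspace (quotient_topology Y q) = q ` topspace Y"
proof -
  have "{x \<in> topspace Y. q x \<in> q ` topspace Y} = topspace Y"
    by blast
  then have "openin (quotient_topology Y q) (q ` topspace Y)"
    by (simp add: openin_quotient_topology)
  then show ?thesis
    using openin_subset iffD1 [OF openin_quotient_topology openin_topspace, of Y q]
    by (intro subset_antisym) blast+
qed

lemma quotient_map_quotient_topology:
  "quotient_map Y (quotient_topology Y q) q"
  by (auto simp: quotient_map_def openin_quotient_topology)

text \<open>The compact-open topology on the path space. A path is represented by a function that is
  undefined outside the unit interval, so that equality of paths is equality of functions.\<close>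

definition path_set :: "'a topology \<Rightarrow> (real \<Rightarrow> 'a) set"
  where "path_set X = {\<alpha> \<in> extensional {0..1}. pathin X \<alpha>}"

definition path_space :: "'a topology \<Rightarrow> (real \<Rightarrow> 'a) topology"
  where "path_space X = topology_generated_by
    {{\<alpha> \<in> path_set X. \<alpha> ` K \<subseteq> V} |K V. compactin unit_interval K \<and> openin X V}"

definition const_path :: "'a \<Rightarrow> real \<Rightarrow> 'a"
  where "const_path x = (\<lambda>t\<in>{0..1}. x)"

definition endpoints :: "(real \<Rightarrow> 'a) \<Rightarrow> 'a \<times> 'a"
  where "endpoints \<alpha> = (\<alpha> 0, \<alpha> 1)"

definition NDR_pair :: "'a topology \<Rightarrow> 'a set \<Rightarrow> bool"
  where "NDR_pair Y A \<longleftrightarrow> A \<subseteq> topspace Y \<and>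
    (\<exists>u h. continuous_map Y unit_interval u \<and>
           A = {y \<in> topspace Y. u y = 0} \<and>
           continuous_map (prod_topology Y unit_interval) Y h \<and>
           (\<forall>y \<in> topspace Y. h (y, 0) = y) \<and>
           (\<forall>a \<in> A. \<forall>t \<in> {0..1}. h (a, t) = a) \<and>
           (\<forall>y \<in> topspace Y. u y < 1 \<longrightarrow> h (y, 1) \<in> A))"


section \<open>Simplicial complexes\<close>

text \<open>The library's notion of a simplicial complex is that of a finite one embedded in a Euclidean
  space. Here complexes are arbitrary, and their points are given by barycentric coordinates.\<close>

definition abstract_simplicial_complex :: "'v set set \<Rightarrow> bool"
  where "abstract_simplicial_complex K \<longleftrightarrow>
    (\<forall>\<sigma> \<in> K. finite \<sigma> \<and> \<sigma> \<noteq> {}) \<and>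
    (\<forall>\<sigma> \<in> K. \<forall>\<tau>. \<tau> \<subseteq> \<sigma> \<and> \<tau> \<noteq> {} \<longrightarrow> \<tau> \<in> K)"

definition closed_simplex :: "'v set \<Rightarrow> ('v \<Rightarrow> real) set"
  where "closed_simplex \<sigma> =
    {f. (\<forall>v \<in> \<sigma>. 0 \<le> f v) \<and> (\<forall>v. v \<notin> \<sigma> \<longrightarrow> f v = 0) \<and> (\<Sum>v\<in>\<sigma>. f v) = 1}"

text \<open>The weak topology: a set is open iff it is relatively open in every closed simplex.\<close>

definition geometric_realization :: "'v set set \<Rightarrow> ('v \<Rightarrow> real) topology"
  where "geometric_realization K =
    topology (\<lambda>U. U \<subseteq> (\<Union>\<sigma>\<in>K. closed_simplex \<sigma>) \<and>
      (\<forall>\<sigma> \<in> K. openin (subtopology (powertop_real UNIV) (closed_simplex \<sigma>))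
                      (U \<inter> closed_simplex \<sigma>)))"

lemma openin_geometric_realization:
  "openin (geometric_realization K) U \<longleftrightarrow>
     U \<subseteq> (\<Union>\<sigma>\<in>K. closed_simplex \<sigma>) \<and>
     (\<forall>\<sigma> \<in> K. openin (subtopology (powertop_real UNIV) (closed_simplex \<sigma>))
                     (U \<inter> closed_simplex \<sigma>))"
proof -
  let ?T = "\<lambda>\<sigma>. subtopology (powertop_real UNIV) (closed_simplex \<sigma>)"
  let ?L = "\<lambda>U. U \<subseteq> (\<Union>\<sigma>\<in>K. closed_simplex \<sigma>) \<and>
      (\<forall>\<sigma> \<in> K. openin (?T \<sigma>) (U \<inter> closed_simplex \<sigma>))"
  have "istopology ?L"
    unfolding istopology_def
  proof (intro conjI allI impI ballI)
    fix S T \<sigma> assume *: "?L S" "?L T" "\<sigma> \<in> K"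
    have "(S \<inter> T) \<inter> closed_simplex \<sigma> = (S \<inter> closed_simplex \<sigma>) \<inter> (T \<inter> closed_simplex \<sigma>)"
      by blast
    then show "openin (?T \<sigma>) ((S \<inter> T) \<inter> closed_simplex \<sigma>)"
      using * by (metis openin_Int)
  next
    fix S T assume "?L S" "?L T"
    then show "S \<inter> T \<subseteq> (\<Union>\<sigma>\<in>K. closed_simplex \<sigma>)" by blast
  next
    fix \<K> \<sigma> assume *: "\<forall>U\<in>\<K>. ?L U" "\<sigma> \<in> K"
    then have "openin (?T \<sigma>) (\<Union>U\<in>\<K>. U \<inter> closed_simplex \<sigma>)"
      by blast
    moreover have "\<Union>\<K> \<inter> closed_simplex \<sigma> = (\<Union>U\<in>\<K>. U \<inter> closed_simplex \<sigma>)"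
      by blast
    ultimately show "openin (?T \<sigma>) (\<Union>\<K> \<inter> closed_simplex \<sigma>)"
      by (simp only:)
  next
    fix \<K> assume "\<forall>U\<in>\<K>. ?L U"
    then show "\<Union>\<K> \<subseteq> (\<Union>\<sigma>\<in>K. closed_simplex \<sigma>)" by blast
  qed
  then show ?thesis
    by (simp add: geometric_realization_def topology_inverse')
qed


section \<open>Fibrewise pointed spaces\<close>

record ('b, 'e) fibrewise_pointed =
  total_space :: "'e topology"
  projection :: "'e \<Rightarrow> 'b"
  basepoint_section :: "'b \<Rightarrow> 'e"

definition fibrewise_pointed_space :: "'b topology \<Rightarrow> ('b, 'e) fibrewise_pointed \<Rightarrow> bool"
  where "fibrewise_pointed_space B E \<longleftrightarrow>
    continuous_map (total_space E) B (projection E) \<and>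
    continuous_map B (total_space E) (basepoint_section E) \<and>
    (\<forall>b \<in> topspace B. projection E (basepoint_section E b) = b)"

definition fibrewise_pointed_map ::
    "'b topology \<Rightarrow> ('b, 'e) fibrewise_pointed \<Rightarrow> ('b, 'f) fibrewise_pointed \<Rightarrow> ('e \<Rightarrow> 'f) \<Rightarrow> bool"
  where "fibrewise_pointed_map B E F f \<longleftrightarrow>
    fibrewise_pointed_space B E \<and> fibrewise_pointed_space B F \<and>
    continuous_map (total_space E) (total_space F) f \<and>
    (\<forall>e \<in> topspace (total_space E). projection F (f e) = projection E e) \<and>
    (\<forall>b \<in> topspace B. f (basepoint_section E b) = basepoint_section F b)"

definition fibrewise_square :: "'a topology \<Rightarrow> ('a, 'a \<times> 'a) fibrewise_pointed"
  where "fibrewise_square X =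
    \<lparr>total_space = square X, projection = fst, basepoint_section = diag\<rparr>"

lemma fibrewise_pointed_space_square: "fibrewise_pointed_space X (fibrewise_square X)"
  by (simp add: fibrewise_pointed_space_def fibrewise_square_def continuous_map_fst
      continuous_map_paired)


section \<open>Monoidal topological complexity\<close>

definition fibrewise_pointed_categorical :: "'a topology \<Rightarrow> ('a \<times> 'a) set \<Rightarrow> bool"
  where "fibrewise_pointed_categorical X U \<longleftrightarrow>
    openin (square X) U \<and> diag ` topspace X \<subseteq> U \<and>
    (\<exists>H. continuous_map (prod_topology (subtopology (square X) U) unit_interval) (square X) H \<and>
         (\<forall>z \<in> U. \<forall>t \<in> {0..1}. fst (H (z, t)) = fst z) \<and>
         (\<forall>z \<in> U. H (z, 0) = z) \<and>
         (\<forall>x \<in> topspace X. \<forall>t \<in> {0..1}. H (diag x, t) = diag x) \<and>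
         (\<forall>z \<in> U. H (z, 1) \<in> diag ` topspace X))"

text \<open>The infimum of the empty set in the extended naturals is infinity.\<close>

definition monoidal_TC :: "'a topology \<Rightarrow> enat"
  where "monoidal_TC X =
    (INF n \<in> {n. \<exists>U :: nat \<Rightarrow> ('a \<times> 'a) set.
                  (\<forall>i<n. fibrewise_pointed_categorical X (U i)) \<and>
                  (\<Union>i<n. U i) = topspace (square X)}. enat n)"


section \<open>Fibrewise joins\<close>

text \<open>The join of \<open>p i : E i \<rightarrow> B\<close> for \<open>i < n\<close>. Before identification, a point is a family
  of pairs \<open>(e\<^sub>i, t\<^sub>i)\<close> with all \<open>p i e\<^sub>i\<close> equal and \<open>max t\<^sub>i = 1\<close>; as the \<open>t\<^sub>i\<close> lie in the unit
  interval, the latter says that some \<open>t\<^sub>i\<close> is 1 (and there is no such point if \<open>n = 0\<close>).\<close>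

definition prejoin ::
    "nat \<Rightarrow> (nat \<Rightarrow> 'e topology) \<Rightarrow> (nat \<Rightarrow> 'e \<Rightarrow> 'b) \<Rightarrow> (nat \<Rightarrow> 'e \<times> real) topology"
  where "prejoin n E p =
    subtopology (product_topology (\<lambda>i. prod_topology (E i) unit_interval) {..<n})
      {w. (\<forall>i<n. \<forall>j<n. p i (fst (w i)) = p j (fst (w j))) \<and> (\<exists>i<n. snd (w i) = 1)}"

text \<open>The coordinate \<open>e\<^sub>i\<close> is disregarded when \<open>t\<^sub>i = 0\<close>. For \<open>n = 2\<close> this is the
  identification \<open>(e, 0, e', 1) \<sim> (d, 0, e', 1)\<close> and \<open>(e, 1, e', 0) \<sim> (e, 1, d', 0)\<close>.\<close>

definition join_rel ::
    "nat \<Rightarrow> (nat \<Rightarrow> 'e topology) \<Rightarrow> (nat \<Rightarrow> 'e \<Rightarrow> 'b) \<Rightarrow>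
     ((nat \<Rightarrow> 'e \<times> real) \<times> (nat \<Rightarrow> 'e \<times> real)) set"
  where "join_rel n E p =
    {(w, w'). w \<in> topspace (prejoin n E p) \<and> w' \<in> topspace (prejoin n E p) \<and>
       (\<forall>i<n. snd (w i) = snd (w' i) \<and> (snd (w i) \<noteq> 0 \<longrightarrow> fst (w i) = fst (w' i)))}"

definition join_class ::
    "nat \<Rightarrow> (nat \<Rightarrow> 'e topology) \<Rightarrow> (nat \<Rightarrow> 'e \<Rightarrow> 'b) \<Rightarrow>
     (nat \<Rightarrow> 'e \<times> real) \<Rightarrow> (nat \<Rightarrow> 'e \<times> real) set"
  where "join_class n E p w = join_rel n E p `` {w}"

definition fibrewise_join ::
    "nat \<Rightarrow> (nat \<Rightarrow> 'e topology) \<Rightarrow> (nat \<Rightarrow> 'e \<Rightarrow> 'b) \<Rightarrow> (nat \<Rightarrow> 'e \<times> real) set topology"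
  where "fibrewise_join n E p = quotient_topology (prejoin n E p) (join_class n E p)"

definition join_proj :: "nat \<Rightarrow> (nat \<Rightarrow> 'e \<Rightarrow> 'b) \<Rightarrow> (nat \<Rightarrow> 'e \<times> real) set \<Rightarrow> 'b"
  where "join_proj n p c = (THE b. \<forall>w \<in> c. \<forall>i<n. p i (fst (w i)) = b)"

lemma topspace_prejoin:
  "topspace (prejoin n E p) = (\<Pi>\<^sub>E i\<in>{..<n}. topspace (E i) \<times> {0..1}) \<inter>
     {w. (\<forall>i<n. \<forall>j<n. p i (fst (w i)) = p j (fst (w j))) \<and> (\<exists>i<n. snd (w i) = 1)}"
  unfolding prejoin_def topspace_subtopology topspace_product_topology topspace_prod_topology
  by simp

lemma equiv_join_rel: "equiv (topspace (prejoin n E p)) (join_rel n E p)"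
proof (intro equivI)
  show "sym (join_rel n E p)"
    unfolding sym_def join_rel_def by force
  show "trans (join_rel n E p)"
    unfolding trans_def join_rel_def by force
qed (auto simp: join_rel_def refl_on_def)

lemma join_proj_join_class:
  assumes w: "w \<in> topspace (prejoin n E p)" and i: "i < n"
  shows "join_proj n p (join_class n E p w) = p i (fst (w i))"
  unfolding join_proj_def
proof (rule the_equality)
  have fib: "p j (fst (v j)) = p k (fst (v k))"
    if "v \<in> topspace (prejoin n E p)" "j < n" "k < n" for v j k
    using that unfolding topspace_prejoin by blast
  have *: "p j (fst (w' j)) = p i (fst (w i))" if w': "w' \<in> join_class n E p w" and j: "j < n" for w' j
  proof -
    obtain k where k: "k < n" "snd (w k) = 1"
      using w unfolding topspace_prejoin by blast
    have "w' \<in> topspace (prejoin n E p)" "fst (w k) = fst (w' k)"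
      using w' k by (simp_all add: join_class_def join_rel_def)
    then show ?thesis
      using fib [OF w i k(1)] fib [OF _ j k(1), of w'] by simp
  qed
  then show "\<forall>w' \<in> join_class n E p w. \<forall>j<n. p j (fst (w' j)) = p i (fst (w i))"
    by blast
  have self: "w \<in> join_class n E p w"
    unfolding join_class_def using equiv_class_self [OF equiv_join_rel w] .
  show "b = p i (fst (w i))"
    if "\<forall>w' \<in> join_class n E p w. \<forall>j<n. p j (fst (w' j)) = b" for b
    using bspec [OF that self] i by simp
qed


section \<open>The fibrewise Ganea spaces\<close>

definition ganea_point :: "'a topology \<Rightarrow> nat \<Rightarrow> 'a \<Rightarrow> (nat \<Rightarrow> (real \<Rightarrow> 'a) \<times> real) set"
  where "ganea_point X n x =
    join_class n (\<lambda>_. path_space X) (\<lambda>_. endpoints) (\<lambda>i\<in>{..<n}. (const_path x, 1))"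

definition ganea_proj :: "nat \<Rightarrow> (nat \<Rightarrow> (real \<Rightarrow> 'a) \<times> real) set \<Rightarrow> 'a \<times> 'a"
  where "ganea_proj n = join_proj n (\<lambda>_. endpoints)"

definition fibrewise_ganea ::
    "'a topology \<Rightarrow> nat \<Rightarrow> ('a, (nat \<Rightarrow> (real \<Rightarrow> 'a) \<times> real) set) fibrewise_pointed"
  where "fibrewise_ganea X n =
    \<lparr>total_space = fibrewise_join n (\<lambda>_. path_space X) (\<lambda>_. endpoints),
     projection = fst \<circ> ganea_proj n,
     basepoint_section = ganea_point X n\<rparr>"

definition ganea_section :: "'a topology \<Rightarrow> nat \<Rightarrow> ('a \<times> 'a \<Rightarrow> (nat \<Rightarrow> (real \<Rightarrow> 'a) \<times> real) set) \<Rightarrow> bool"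
  where "ganea_section X n s \<longleftrightarrow>
    fibrewise_pointed_map X (fibrewise_square X) (fibrewise_ganea X n) s \<and>
    (\<forall>z \<in> topspace (square X). ganea_proj n (s z) = z)"

lemma topspace_path_space [simp]: "topspace (path_space X) = path_set X"
proof -
  have "path_set X = {\<alpha> \<in> path_set X. \<alpha> ` {} \<subseteq> topspace X}" by simp
  then have "path_set X \<in> {{\<alpha> \<in> path_set X. \<alpha> ` K \<subseteq> V} |K V. compactin unit_interval K \<and> openin X V}"
    using compactin_empty openin_topspace by blast
  then show ?thesis
    unfolding path_space_def topology_generated_by_topspace by blast
qed

lemma const_path_continuous: "continuous_map X (path_space X) const_path"
proof -
  have ps: "const_path x \<in> path_set X" if "x \<in> topspace X" for x
  proof -
    have "pathin X (const_path x) = pathin X (\<lambda>t. x)"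
      unfolding pathin_def by (auto simp: const_path_def elim: continuous_map_eq)
    then show ?thesis using that by (auto simp: path_set_def const_path_def pathin_const)
  qed
  show ?thesis
    unfolding path_space_def
  proof (rule continuous_on_generated_topo, goal_cases)
    case (1 U)
    then obtain K V where U: "U = {\<alpha> \<in> path_set X. \<alpha> ` K \<subseteq> V}" "compactin unit_interval K" "openin X V"
      by blast
    have K: "K \<subseteq> {0..1}" using U(2) compactin_subset_topspace by fastforce
    have "const_path -` U \<inter> topspace X = (if K = {} then topspace X else V)"
    proof (cases "K = {}")
      case False
      have "const_path x ` K = {x}" for x :: 'a
        using K False by (auto simp: const_path_def image_iff subset_iff)
      then show ?thesis
        using False ps openin_subset [OF U(3)] by (auto simp: U(1))
    qed (use ps in \<open>auto simp: U(1)\<close>)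
    then show ?case using U(3) by simp
  next
    case 2
    have "topspace (path_space X) = path_set X" by simp
    then show ?case using ps unfolding path_space_def topology_generated_by_topspace by blast
  qed
qed

lemma continuous_map_endpoints: "continuous_map (path_space X) (square X) endpoints"
proof -
  have ev: "continuous_map (path_space X) X (\<lambda>\<alpha>. \<alpha> r)" if r: "r \<in> {0..1}" for r
    unfolding continuous_map_def
  proof (intro conjI allI impI)
    show "(\<lambda>\<alpha>. \<alpha> r) \<in> topspace (path_space X) \<rightarrow> topspace X"
      using r by (auto simp: path_set_def pathin_def continuous_map_def Pi_iff)
    fix V assume "openin X V"
    moreover have eq: "{\<alpha> \<in> topspace (path_space X). \<alpha> r \<in> V} = {\<alpha> \<in> path_set X. \<alpha> ` {r} \<subseteq> V}"
      by auto
    moreover have "compactin unit_interval {r}" using r by simp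
    ultimately have "openin (path_space X) {\<alpha> \<in> path_set X. \<alpha> ` {r} \<subseteq> V}"
      unfolding path_space_def by (intro topology_generated_by_Basis) blast
    with eq show "openin (path_space X) {\<alpha> \<in> topspace (path_space X). \<alpha> r \<in> V}"
      by simp
  qed
  show ?thesis
    unfolding endpoints_def by (intro continuous_map_pairedI ev) auto
qed

lemma ganea_basepoint:
  assumes "0 < n" "x \<in> topspace X"
  shows "(\<lambda>i\<in>{..<n}. (const_path x, 1)) \<in> topspace (prejoin n (\<lambda>_. path_space X) (\<lambda>_. endpoints))"
proof -
  have "const_path x \<in> path_set X"
    using assms(2) continuous_map_image_subset_topspace [OF const_path_continuous, of X] by auto
  then show ?thesis
    unfolding topspace_prejoin using assms(1) by auto
qed

lemma continuous_map_ganea_proj: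
  assumes "0 < n"
  shows "continuous_map (fibrewise_join n (\<lambda>_. path_space X) (\<lambda>_. endpoints)) (square X) (ganea_proj n)"
proof -
  let ?P = "prejoin n (\<lambda>_. path_space X) (\<lambda>_. endpoints)"
  let ?q = "join_class n (\<lambda>_. path_space X) (\<lambda>_. endpoints)"
  have "continuous_map ?P (prod_topology (path_space X) unit_interval) (\<lambda>w. w 0)"
    unfolding prejoin_def using assms
    by (intro continuous_map_from_subtopology continuous_map_product_projection) auto
  then have "continuous_map ?P (square X) (endpoints \<circ> (fst \<circ> (\<lambda>w. w 0)))"
    by (intro continuous_map_compose [OF _ continuous_map_endpoints]
        continuous_map_compose [OF _ continuous_map_fst])
  then have "continuous_map ?P (square X) (ganea_proj n \<circ> ?q)"
    by (rule continuous_map_eq)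
       (simp add: ganea_proj_def join_proj_join_class [OF _ assms])
  then show ?thesis
    unfolding fibrewise_join_def
    by (rule continuous_compose_quotient_map [OF quotient_map_quotient_topology])
qed

lemma fibrewise_pointed_space_ganea:
  assumes "0 < n"
  shows "fibrewise_pointed_space X (fibrewise_ganea X n)"
proof -
  let ?P = "prejoin n (\<lambda>_. path_space X) (\<lambda>_. endpoints)"
  let ?q = "join_class n (\<lambda>_. path_space X) (\<lambda>_. endpoints)"
  let ?b = "\<lambda>x. (\<lambda>i\<in>{..<n}. (const_path x, 1::real))"
  have "continuous_map X (product_topology (\<lambda>i. prod_topology (path_space X) unit_interval) {..<n}) ?b"
    unfolding continuous_map_componentwise
    by (auto intro!: continuous_map_pairedI const_path_continuous)
  then have "continuous_map X ?P ?b"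
    unfolding prejoin_def continuous_map_in_subtopology using assms by auto
  then have s: "continuous_map X (fibrewise_join n (\<lambda>_. path_space X) (\<lambda>_. endpoints)) (ganea_point X n)"
    unfolding fibrewise_join_def
    using continuous_map_compose [OF _ quotient_imp_continuous_map [OF quotient_map_quotient_topology], of X ?P ?b ?q]
    by (simp add: o_def ganea_point_def [abs_def])
  have "ganea_proj n (ganea_point X n x) = (x, x)" if "x \<in> topspace X" for x
    unfolding ganea_proj_def ganea_point_def
      join_proj_join_class [OF ganea_basepoint [OF assms that] assms]
    using assms by (simp add: endpoints_def const_path_def)
  then show ?thesis
    using s continuous_map_compose [OF continuous_map_ganea_proj [OF assms] continuous_map_fst, of X]
    by (simp add: fibrewise_pointed_space_def fibrewise_ganea_def)
qed

end

theory Submission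
  imports Defs
begin

text \<open>A fibrewise pointed categorical set \<open>U\<close> is the same as an open set containing the diagonal over
  which there is a continuous choice of paths \<open>\<alpha> (x, y)\<close> from \<open>x\<close> to \<open>y\<close>, constant over the diagonal
  (lemma \<open>fibrewise_pointed_categorical_iff_paths\<close>). A point of the \<open>n\<close>-fold join over \<open>(x, y)\<close> is a
  list of \<open>n\<close> such paths with weights, of which at least one is 1 and in which paths of weight 0 are
  forgotten. So covers by \<open>n\<close> categorical sets and sections of the join should correspond to each
  other for every \<open>n\<close>, and then the two least numbers agree.

  From a section to a cover the passage is direct: take the sets on which the \<open>i\<close>-th weight is
  non-zero (lemma \<open>cover_of_ganea_section\<close>).

  Conversely, a cover \<open>U i\<close> with paths \<open>\<alpha> i\<close> gives a section as soon as there are continuous weights \<open>t i\<close>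
  that vanish outside closed subsets of \<open>U i\<close>, attain 1 at every point for some \<open>i\<close>, and are all 1 on
  the diagonal (lemmas \<open>map_into_fibrewise_join\<close> and \<open>ganea_section_of_cover\<close>). Such weights exist in a
  normal space if the diagonal is closed (lemma \<open>weights_subordinate_to_cover\<close>). The diagonal is closed
  because it is the zero set of the function in an NDR pair. Normality is a property of all
  simplicial complexes in the weak topology, shown here by extending functions from a closed set
  over one skeleton after the other (lemma \<open>extend_over_geometric_realization\<close>).\<close>

section \<open>Simplicial complexes are normal\<close>

lemma topspace_geometric_realization:
  "topspace (geometric_realization K) = (\<Union>\<sigma>\<in>K. closed_simplex \<sigma>)"
proof (rule subset_antisym)
  show "topspace (geometric_realization K) \<subseteq> (\<Union>\<sigma>\<in>K. closed_simplex \<sigma>)"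
    using openin_topspace [of "geometric_realization K"]
    unfolding openin_geometric_realization by blast
  have "openin (geometric_realization K) (\<Union>\<sigma>\<in>K. closed_simplex \<sigma>)"
    unfolding openin_geometric_realization
  proof (intro conjI ballI)
    fix \<sigma> assume "\<sigma> \<in> K"
    then have "(\<Union>\<sigma>\<in>K. closed_simplex \<sigma>) \<inter> closed_simplex \<sigma>
        = topspace (subtopology (powertop_real UNIV) (closed_simplex \<sigma>))"
      by auto
    then show "openin (subtopology (powertop_real UNIV) (closed_simplex \<sigma>))
        ((\<Union>\<sigma>\<in>K. closed_simplex \<sigma>) \<inter> closed_simplex \<sigma>)"
      by (metis openin_topspace)
  qed simp
  then show "(\<Union>\<sigma>\<in>K. closed_simplex \<sigma>) \<subseteq> topspace (geometric_realization K)"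
    by (rule openin_subset)
qed

lemma continuous_map_from_geometric_realization:
  assumes "\<And>\<sigma>. \<sigma> \<in> K \<Longrightarrow>
    continuous_map (subtopology (powertop_real UNIV) (closed_simplex \<sigma>)) Z f"
  shows "continuous_map (geometric_realization K) Z f"
  unfolding continuous_map_def
proof (intro conjI allI impI)
  show "f \<in> topspace (geometric_realization K) \<rightarrow> topspace Z"
    using assms continuous_map_funspace
    by (fastforce simp: topspace_geometric_realization)
  fix V assume V: "openin Z V"
  show "openin (geometric_realization K) {x \<in> topspace (geometric_realization K). f x \<in> V}"
    unfolding openin_geometric_realization
  proof (intro conjI ballI)
    fix \<sigma> assume \<sigma>: "\<sigma> \<in> K"
    have "{x \<in> topspace (geometric_realization K). f x \<in> V} \<inter> closed_simplex \<sigma>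
        = {x \<in> topspace (subtopology (powertop_real UNIV) (closed_simplex \<sigma>)). f x \<in> V}"
      using \<sigma> by (auto simp: topspace_geometric_realization)
    then show "openin (subtopology (powertop_real UNIV) (closed_simplex \<sigma>))
        ({x \<in> topspace (geometric_realization K). f x \<in> V} \<inter> closed_simplex \<sigma>)"
      using openin_continuous_map_preimage [OF assms [OF \<sigma>] V] by simp
  qed (auto simp: topspace_geometric_realization)
qed

lemma continuous_map_closed_simplex_inclusion:
  assumes "\<sigma> \<in> K"
  shows "continuous_map (subtopology (powertop_real UNIV) (closed_simplex \<sigma>))
           (geometric_realization K) (\<lambda>x. x)"
  unfolding continuous_map_def
proof (intro conjI allI impI)
  show "(\<lambda>x. x) \<in> topspace (subtopology (powertop_real UNIV) (closed_simplex \<sigma>)) \<rightarrow>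
      topspace (geometric_realization K)"
    using assms by (auto simp: topspace_geometric_realization)
  fix U assume U: "openin (geometric_realization K) U"
  have "{x \<in> topspace (subtopology (powertop_real UNIV) (closed_simplex \<sigma>)). x \<in> U}
      = U \<inter> closed_simplex \<sigma>"
    by auto
  then show "openin (subtopology (powertop_real UNIV) (closed_simplex \<sigma>))
      {x \<in> topspace (subtopology (powertop_real UNIV) (closed_simplex \<sigma>)). x \<in> U}"
    using U assms unfolding openin_geometric_realization by simp
qed

lemma closed_closed_simplex: "closed (closed_simplex \<sigma>)"
proof -
  have "closed_simplex \<sigma> = (\<Inter>v\<in>\<sigma>. {f. 0 \<le> f v}) \<inter> (\<Inter>v\<in>-\<sigma>. {f. f v = 0})
      \<inter> {f. (\<Sum>v\<in>\<sigma>. f v) = 1}"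
    by (auto simp: closed_simplex_def)
  also have "closed \<dots>"
    by (intro closed_Int closed_INT ballI closed_Collect_le closed_Collect_eq
        continuous_on_sum continuous_on_product_coordinates continuous_intros)
  finally show ?thesis .
qed

lemma closedin_closed_simplex: "closedin (powertop_real UNIV) (closed_simplex \<sigma>)"
  using closed_closed_simplex by (simp add: euclidean_product_topology)

lemma closed_simplex_coordinate_bounds:
  assumes "finite \<sigma>" "x \<in> closed_simplex \<sigma>"
  shows "x v \<in> {0..1}"
proof (cases "v \<in> \<sigma>")
  case True
  then have "x v \<le> (\<Sum>v\<in>\<sigma>. x v)"
    using assms by (intro member_le_sum) (auto simp: closed_simplex_def)
  then show ?thesis using True assms by (auto simp: closed_simplex_def)
next
  case False
  then show ?thesis using assms by (auto simp: closed_simplex_def)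
qed

text \<open>A simplex is a closed subset of a Tychonoff cube, hence compact.\<close>

lemma normal_space_closed_simplex:
  assumes "finite \<sigma>"
  shows "normal_space (subtopology (powertop_real UNIV) (closed_simplex \<sigma>))"
proof (rule compact_Hausdorff_or_regular_imp_normal_space)
  have "compactin (powertop_real UNIV) (PiE UNIV (\<lambda>_. {0..1}))"
    by (simp add: compactin_PiE)
  then have "compactin (powertop_real UNIV) (closed_simplex \<sigma>)"
    by (rule closed_compactin [OF _ _ closedin_closed_simplex])
       (use closed_simplex_coordinate_bounds [OF assms] in \<open>auto simp: PiE_UNIV_domain\<close>)
  then show "compact_space (subtopology (powertop_real UNIV) (closed_simplex \<sigma>))"
    by (rule compact_space_subtopology)
  show "Hausdorff_space (subtopology (powertop_real UNIV) (closed_simplex \<sigma>)) \<or>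
      regular_space (subtopology (powertop_real UNIV) (closed_simplex \<sigma>))"
    by (intro disjI1 Hausdorff_space_subtopology) (simp add: Hausdorff_space_product_topology)
qed

text \<open>Every point of a complex lies in the interior of exactly one simplex, the one spanned by its
  support. A function can therefore be prescribed separately on each open simplex.\<close>

definition support :: "('v \<Rightarrow> real) \<Rightarrow> 'v set"
  where "support x = {v. x v \<noteq> 0}"

lemma closed_simplex_empty: "closed_simplex {} = {}"
  by (simp add: closed_simplex_def)

lemma support_subset: "x \<in> closed_simplex \<sigma> \<Longrightarrow> support x \<subseteq> \<sigma>"
  by (auto simp: support_def closed_simplex_def)

lemma support_proper_imp_facet:
  assumes "x \<in> closed_simplex \<sigma>" "finite \<sigma>" "support x \<noteq> \<sigma>"
  obtains v where "v \<in> \<sigma>" "x \<in> closed_simplex (\<sigma> - {v})"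
proof -
  obtain v where v: "v \<in> \<sigma>" "x v = 0"
    using assms support_subset [OF assms(1)] by (auto simp: support_def)
  then have "x \<in> closed_simplex (\<sigma> - {v})"
    using assms by (auto simp: closed_simplex_def sum.remove)
  with v show ?thesis using that by blast
qed

lemma closed_simplex_mono:
  assumes "\<tau> \<subseteq> \<sigma>" "finite \<sigma>" shows "closed_simplex \<tau> \<subseteq> closed_simplex \<sigma>"
proof
  fix x assume x: "x \<in> closed_simplex \<tau>"
  then have "(\<Sum>v\<in>\<sigma>. x v) = (\<Sum>v\<in>\<tau>. x v)"
    using assms by (intro sum.mono_neutral_right) (auto simp: closed_simplex_def)
  moreover have "0 \<le> x v" for v
    using x by (cases "v \<in> \<tau>") (auto simp: closed_simplex_def)
  ultimately show "x \<in> closed_simplex \<sigma>"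
    using x assms by (auto simp: closed_simplex_def)
qed

text \<open>The inductive step over the skeleta. The facets of \<open>\<sigma>\<close> together with \<open>C\<close> form a finite closed
  family, on which \<open>g\<close> and \<open>h\<close> can be pasted; Tietze's theorem in the compact space \<open>\<sigma>\<close> does the rest.\<close>

lemma extend_over_simplex:
  fixes g h :: "('v \<Rightarrow> real) \<Rightarrow> real"
  assumes fin: "finite \<sigma>"
    and C: "closedin (subtopology (powertop_real UNIV) (closed_simplex \<sigma>)) C"
    and h: "continuous_map (subtopology (powertop_real UNIV) C) euclideanreal h"
    and g: "\<And>v. v \<in> \<sigma> \<Longrightarrow>
      continuous_map (subtopology (powertop_real UNIV) (closed_simplex (\<sigma> - {v}))) euclideanreal g"
    and gh: "\<And>v x. v \<in> \<sigma> \<Longrightarrow> x \<in> closed_simplex (\<sigma> - {v}) \<Longrightarrow> x \<in> C \<Longrightarrow> g x = h x"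
  obtains k where
    "continuous_map (subtopology (powertop_real UNIV) (closed_simplex \<sigma>)) euclideanreal k"
    "\<And>x. x \<in> C \<Longrightarrow> k x = h x"
    "\<And>v x. v \<in> \<sigma> \<Longrightarrow> x \<in> closed_simplex (\<sigma> - {v}) \<Longrightarrow> k x = g x"
proof -
  let ?S = "subtopology (powertop_real UNIV) (closed_simplex \<sigma>)"
  define T where "T = (\<lambda>i. case i of None \<Rightarrow> C | Some v \<Rightarrow> closed_simplex (\<sigma> - {v}))"
  define f where "f = (\<lambda>i::'v option. case i of None \<Rightarrow> h | Some v \<Rightarrow> g)"
  define I where "I = insert None (Some ` \<sigma>)"
  define D where "D = (\<Union>i\<in>I. T i)"
  have finI: "finite I" using fin by (simp add: I_def)
  have facet: "closed_simplex (\<sigma> - {v}) \<subseteq> closed_simplex \<sigma>" for v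
    using fin by (intro closed_simplex_mono) auto
  have clo: "closedin ?S (T i)" if "i \<in> I" for i
    using C closedin_subset_topspace [OF closedin_closed_simplex facet]
    by (simp add: T_def split: option.split)
  have D: "closedin ?S D"
    unfolding D_def using finI clo by (intro closedin_Union) auto
  then have DS: "D \<subseteq> closed_simplex \<sigma>"
    using closedin_subset by fastforce
  have sub: "subtopology (subtopology ?S D) (T i) = subtopology (powertop_real UNIV) (T i)"
    if "i \<in> I" for i
  proof -
    have "T i \<subseteq> D" using that by (auto simp: D_def)
    with DS show ?thesis by (simp add: subtopology_subtopology Int_absorb1 Int_absorb2 inf.absorb2)
  qed
  obtain \<phi> where \<phi>: "continuous_map (subtopology ?S D) euclideanreal \<phi>"
    and \<phi>f: "\<And>x i. \<lbrakk>i \<in> I; x \<in> topspace (subtopology ?S D) \<inter> T i\<rbrakk> \<Longrightarrow> \<phi> x = f i x"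
  proof (rule pasting_lemma_exists_closed [OF finI, of "subtopology ?S D" T euclideanreal f])
    show "topspace (subtopology ?S D) \<subseteq> \<Union> (T ` I)" by (auto simp: D_def)
    show "closedin (subtopology ?S D) (T i)" if "i \<in> I" for i
    proof (rule closedin_subset_topspace [OF clo [OF that]])
      show "T i \<subseteq> D" using that by (auto simp: D_def)
    qed
    show "continuous_map (subtopology (subtopology ?S D) (T i)) euclideanreal (f i)" if "i \<in> I" for i
      unfolding sub [OF that] using that h g by (auto simp: I_def T_def f_def)
    show "f i x = f j x" if "i \<in> I" "j \<in> I" "x \<in> topspace (subtopology ?S D) \<inter> T i \<inter> T j" for i j x
      using that gh by (auto simp: I_def T_def f_def)
  qed (rule that)
  obtain k where k: "continuous_map ?S euclideanreal k" "\<And>x. x \<in> D \<Longrightarrow> k x = \<phi> x"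
    by (rule Tietze_extension_realinterval
        [OF normal_space_closed_simplex [OF fin] D is_interval_univ UNIV_not_empty \<phi>]) auto
  have kf: "k x = f i x" if "i \<in> I" "x \<in> T i" for i x
  proof -
    have "x \<in> D" using that by (auto simp: D_def)
    then show ?thesis using k(2) \<phi>f [OF that(1)] that(2) DS by auto
  qed
  show ?thesis
  proof (rule that [OF k(1)])
    show "k x = h x" if "x \<in> C" for x
      using kf [of None x] that by (simp add: I_def T_def f_def)
    show "k x = g x" if "v \<in> \<sigma>" "x \<in> closed_simplex (\<sigma> - {v})" for v x
      using kf [of "Some v" x] that by (simp add: I_def T_def f_def)
  qed
qed

text \<open>The extension is built on one skeleton after the other. A continuous function in the weak topology
  is one that is continuous on each closed simplex, so the choices for different simplices of the
  same dimension need no compatibility beyond the boundary values that they share, and the sequence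
  of extensions is stationary on each simplex.\<close>

lemma extend_over_geometric_realization:
  assumes K: "abstract_simplicial_complex K"
    and C: "closedin (geometric_realization K) C"
    and h: "continuous_map (subtopology (geometric_realization K) C) euclideanreal h"
  obtains f where "continuous_map (geometric_realization K) euclideanreal f"
    "\<And>x. x \<in> C \<Longrightarrow> f x = h x"
proof -
  let ?S = "\<lambda>\<sigma>. subtopology (powertop_real UNIV) (closed_simplex \<sigma>)"
  have finK: "finite \<sigma>" "\<sigma> \<noteq> {}" if "\<sigma> \<in> K" for \<sigma>
    using K that by (auto simp: abstract_simplicial_complex_def)
  have face: "\<tau> \<in> K" if "\<sigma> \<in> K" "\<tau> \<subseteq> \<sigma>" "\<tau> \<noteq> {}" for \<sigma> \<tau>
    using K that unfolding abstract_simplicial_complex_def by metis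
  \<comment> \<open>\<open>P n F\<close>: \<open>F\<close> solves the problem on the simplices with at most \<open>n\<close> vertices. \<open>Q n F F'\<close>: passing
    from \<open>F\<close> to \<open>F'\<close> changes nothing there.\<close>
  define P where "P = (\<lambda>n F. \<forall>\<sigma>\<in>K. card \<sigma> \<le> n \<longrightarrow>
    continuous_map (?S \<sigma>) euclideanreal F \<and> (\<forall>x \<in> closed_simplex \<sigma> \<inter> C. F x = h x))"
  define Q where "Q = (\<lambda>n F F'. \<forall>x :: 'a \<Rightarrow> real. card (support x) \<le> n \<longrightarrow> F' x = (F x :: real))"
  have "\<exists>F. \<forall>n. P n (F n) \<and> Q n (F n) (F (Suc n))"
  proof (rule dependent_nat_choice)
    show "\<exists>F. P 0 F"
      using finK by (auto simp: P_def)
  next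
    fix F n assume F: "P n F"
    define R where "R = (\<lambda>\<sigma> k. continuous_map (?S \<sigma>) euclideanreal k \<and>
        (\<forall>x \<in> closed_simplex \<sigma> \<inter> C. k x = h x) \<and>
        (\<forall>v\<in>\<sigma>. \<forall>x \<in> closed_simplex (\<sigma> - {v}). k x = F x))"
    have "\<exists>k. R \<sigma> k" if \<sigma>: "\<sigma> \<in> K" "card \<sigma> = Suc n" for \<sigma>
    proof -
      have facet: "(\<sigma> - {v} \<in> K \<and> card (\<sigma> - {v}) \<le> n) \<or> closed_simplex (\<sigma> - {v}) = {}" if "v \<in> \<sigma>" for v
      proof (cases "\<sigma> - {v} = {}")
        case False
        have "\<sigma> - {v} \<in> K"
          by (rule face [OF \<sigma>(1) _ False]) simp
        then show ?thesis using that \<sigma> by simp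
      next
        case True
        then show ?thesis by (metis closed_simplex_empty)
      qed
      \<comment> \<open>Both the closed set and the function on it restrict to \<open>\<sigma>\<close>, because the inclusion of \<open>\<sigma>\<close>
        into the complex is continuous.\<close>
      have CS: "closedin (?S \<sigma>) (closed_simplex \<sigma> \<inter> C)"
        using closedin_continuous_map_preimage [OF continuous_map_closed_simplex_inclusion [OF \<sigma>(1)] C]
        by (simp add: Int_def)
      have "continuous_map (subtopology (powertop_real UNIV) (closed_simplex \<sigma> \<inter> C))
          (subtopology (geometric_realization K) C) (\<lambda>x. x)"
        unfolding continuous_map_in_subtopology
        using continuous_map_from_subtopology [OF continuous_map_closed_simplex_inclusion [OF \<sigma>(1)], of C]
        by (auto simp: subtopology_subtopology)
      from continuous_map_compose [OF this h]
      have hS: "continuous_map (subtopology (powertop_real UNIV) (closed_simplex \<sigma> \<inter> C)) euclideanreal h"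
        by (simp add: o_def)
      obtain k where
          "continuous_map (?S \<sigma>) euclideanreal k"
          "\<And>x. x \<in> closed_simplex \<sigma> \<inter> C \<Longrightarrow> k x = h x"
          "\<And>v x. v \<in> \<sigma> \<Longrightarrow> x \<in> closed_simplex (\<sigma> - {v}) \<Longrightarrow> k x = F x"
      proof (rule extend_over_simplex [where g = F, OF finK(1) [OF \<sigma>(1)] CS hS])
        show "continuous_map (?S (\<sigma> - {v})) euclideanreal F" if "v \<in> \<sigma>" for v
          using facet [OF that] F unfolding P_def
          by (auto simp: subtopology_eq_discrete_topology_empty)
        show "F x = h x" if "v \<in> \<sigma>" "x \<in> closed_simplex (\<sigma> - {v})" "x \<in> closed_simplex \<sigma> \<inter> C" for v x
          using facet [OF that(1)] F that unfolding P_def by auto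
      qed (rule that)
      then show ?thesis unfolding R_def by blast
    qed
    then obtain k where R: "\<And>\<sigma>. \<sigma> \<in> K \<Longrightarrow> card \<sigma> = Suc n \<Longrightarrow> R \<sigma> (k \<sigma>)"
      by metis
    have k: "continuous_map (?S \<sigma>) euclideanreal (k \<sigma>)"
      and kh: "\<And>x. x \<in> closed_simplex \<sigma> \<inter> C \<Longrightarrow> k \<sigma> x = h x"
      and kF: "\<And>x v. v \<in> \<sigma> \<Longrightarrow> x \<in> closed_simplex (\<sigma> - {v}) \<Longrightarrow> k \<sigma> x = F x"
      if "\<sigma> \<in> K" "card \<sigma> = Suc n" for \<sigma>
      using R [OF that] unfolding R_def by blast+
    \<comment> \<open>Points whose support has \<open>n + 1\<close> vertices are interior to the simplices just treated.\<close>
    define F' where "F' = (\<lambda>x. if card (support x) = Suc n then k (support x) x else F x)"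
    have F'F: "F' x = F x" if "card (support x) \<le> n" for x
      using that by (simp add: F'_def)
    have F'k: "F' x = k \<sigma> x" if \<sigma>: "\<sigma> \<in> K" "card \<sigma> = Suc n" and x: "x \<in> closed_simplex \<sigma>" for \<sigma> x
    proof (cases "support x = \<sigma>")
      case False
      have "support x \<subset> \<sigma>"
        using support_subset [OF x] False by (rule psubsetI)
      with finK(1) [OF \<sigma>(1)] have "card (support x) < card \<sigma>"
        by (rule psubset_card_mono)
      then have "card (support x) \<le> n"
        using \<sigma>(2) by simp
      moreover have "k \<sigma> x = F x"
        by (rule support_proper_imp_facet [OF x finK(1) [OF \<sigma>(1)] False]) (rule kF [OF \<sigma>])
      ultimately show ?thesis by (simp add: F'F)
    qed (use \<sigma> in \<open>simp add: F'_def\<close>)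
    have "continuous_map (?S \<sigma>) euclideanreal F' \<and> (\<forall>x \<in> closed_simplex \<sigma> \<inter> C. F' x = h x)"
      if \<sigma>: "\<sigma> \<in> K" "card \<sigma> \<le> Suc n" for \<sigma>
    proof (cases "card \<sigma> = Suc n")
      case True
      then show ?thesis
        using F'k [OF \<sigma>(1) True] kh [OF \<sigma>(1) True] k [OF \<sigma>(1) True]
        by (auto intro: continuous_map_eq)
    next
      case False
      then have le: "card \<sigma> \<le> n" using \<sigma> by simp
      have eq: "F' x = F x" if "x \<in> closed_simplex \<sigma>" for x
        using F'F card_mono [OF finK(1) [OF \<sigma>(1)] support_subset [OF that]] le by simp
      have "continuous_map (?S \<sigma>) euclideanreal F" "\<forall>x \<in> closed_simplex \<sigma> \<inter> C. F x = h x"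
        using F \<sigma>(1) le unfolding P_def by auto
      then show ?thesis
        using eq by (auto intro: continuous_map_eq)
    qed
    then have "P (Suc n) F'" by (simp add: P_def)
    moreover have "Q n F F'" using F'F by (simp add: Q_def)
    ultimately show "\<exists>F'. P (Suc n) F' \<and> Q n F F'" by blast
  qed
  then obtain F where F: "\<And>n. P n (F n)" and stab: "\<And>n. Q n (F n) (F (Suc n))" by blast
  define f where "f = (\<lambda>x. F (card (support x)) x)"
  \<comment> \<open>From the skeleton containing \<open>x\<close> onwards the sequence no longer changes at \<open>x\<close>.\<close>
  have fF: "f x = F n x" if "card (support x) \<le> n" for n x
    using that
  proof (induction n rule: dec_induct)
    case (step m)
    then show ?case using stab [of m] by (simp add: Q_def)
  qed (simp add: f_def)
  have f: "f x = F (card \<sigma>) x" if "\<sigma> \<in> K" "x \<in> closed_simplex \<sigma>" for \<sigma> x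
    using that by (intro fF card_mono [OF finK(1) support_subset])
  show ?thesis
  proof (rule that [OF continuous_map_from_geometric_realization])
    fix \<sigma> assume \<sigma>: "\<sigma> \<in> K"
    have "continuous_map (?S \<sigma>) euclideanreal (F (card \<sigma>))"
      using F [of "card \<sigma>"] \<sigma> by (simp add: P_def)
    then show "continuous_map (?S \<sigma>) euclideanreal f"
      by (rule continuous_map_eq) (use f [OF \<sigma>] in auto)
  next
    fix x assume x: "x \<in> C"
    then obtain \<sigma> where \<sigma>: "\<sigma> \<in> K" "x \<in> closed_simplex \<sigma>"
      using closedin_subset [OF C] unfolding topspace_geometric_realization by blast
    then show "f x = h x"
      using f [OF \<sigma>] F [of "card \<sigma>"] x by (simp add: P_def)
  qed
qed

theorem normal_space_geometric_realization:
  assumes "abstract_simplicial_complex K"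
  shows "normal_space (geometric_realization K)"
  unfolding normal_space_iff_Tietze
  using extend_over_geometric_realization [OF assms] by metis

section \<open>Weights subordinate to a finite open cover\<close>

text \<open>Induction on the number of sets: the part of \<open>S\<close> that only the last set covers is closed, so
  normality separates it from the complement of that set, and what remains of \<open>S\<close> is covered by the others.\<close>

lemma finite_cover_shrink:
  fixes n :: nat
  assumes Y: "normal_space Y" and S: "closedin Y S"
    and U: "\<And>i. i < n \<Longrightarrow> openin Y (U i)" and cov: "S \<subseteq> (\<Union>i<n. U i)"
  obtains C where "\<And>i. i < n \<Longrightarrow> closedin Y (C i)" "\<And>i. i < n \<Longrightarrow> C i \<subseteq> U i"
    "S \<subseteq> (\<Union>i<n. C i)"
proof -
  have "\<exists>C. (\<forall>i<n. closedin Y (C i) \<and> C i \<subseteq> U i) \<and> S \<subseteq> (\<Union>i<n. C i)"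
    using S U cov
  proof (induction n arbitrary: S)
    case 0
    then show ?case by simp
  next
    case (Suc n)
    have "closedin Y (S - (\<Union>i<n. U i))"
      using Suc.prems by (intro closedin_diff openin_Union) auto
    moreover have "S - (\<Union>i<n. U i) \<subseteq> U n" "openin Y (U n)"
      using Suc.prems by (auto simp: lessThan_Suc)
    ultimately obtain V where V: "openin Y V" "S - (\<Union>i<n. U i) \<subseteq> V" "Y closure_of V \<subseteq> U n"
      using Y unfolding normal_space_alt by meson
    have "closedin Y (S - V)" "S - V \<subseteq> (\<Union>i<n. U i)"
      using Suc.prems(1) V by (auto intro: closedin_diff)
    then obtain C where C: "\<forall>i<n. closedin Y (C i) \<and> C i \<subseteq> U i" "S - V \<subseteq> (\<Union>i<n. C i)"
      using Suc.IH [of "S - V"] Suc.prems(2) by auto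
    have "V \<subseteq> Y closure_of V"
      using V(1) by (simp add: closure_of_subset openin_subset)
    then have "S \<subseteq> (\<Union>i<Suc n. (C(n := Y closure_of V)) i)"
      using C(2) by (fastforce simp: lessThan_Suc)
    moreover have "\<forall>i<Suc n. closedin Y ((C(n := Y closure_of V)) i) \<and> (C(n := Y closure_of V)) i \<subseteq> U i"
      using C(1) V(3) by (auto simp: less_Suc_eq)
    ultimately show ?case by blast
  qed
  then show ?thesis using that by blast
qed

text \<open>Vanishing outside a closed subset of \<open>U\<close> is stronger than vanishing outside \<open>U\<close>: it makes the function
  vanish on a neighbourhood of each point outside \<open>U\<close>, which is what continuity of maps into a join requires.\<close>

lemma Urysohn_supported:
  assumes Y: "normal_space Y" and C: "closedin Y C" and U: "openin Y U" and CU: "C \<subseteq> U"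
  obtains t F where "continuous_map Y unit_interval t" "closedin Y F" "F \<subseteq> U"
    "\<And>y. y \<in> C \<Longrightarrow> t y = 1" "\<And>y. y \<in> topspace Y - F \<Longrightarrow> t y = 0"
proof -
  obtain V where V: "openin Y V" "C \<subseteq> V" "Y closure_of V \<subseteq> U"
    using Y C U CU unfolding normal_space_alt by meson
  have "closedin Y (topspace Y - V)" "disjnt (topspace Y - V) C"
    using V by (auto simp: disjnt_def)
  then obtain t where t: "continuous_map Y unit_interval t"
      "t ` (topspace Y - V) \<subseteq> {0}" "t ` C \<subseteq> {1}"
    using Urysohn_lemma [OF Y _ C, of "topspace Y - V" 0 1] by auto
  have "V \<subseteq> Y closure_of V"
    using V(1) by (simp add: closure_of_subset openin_subset)
  then have "t y = 0" if "y \<in> topspace Y - Y closure_of V" for y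
    using t(2) that by blast
  moreover have "t y = 1" if "y \<in> C" for y
    using t(3) that by blast
  ultimately show ?thesis
    using that [OF t(1) _ V(3)] by simp
qed

text \<open>The weights for the join coordinates. They are not a partition of unity: instead of having sum 1,
  they attain 1 at each point, since the sets on which they are 1 include a closed shrinking of the
  cover. This leaves the freedom to make all of them equal to 1 on \<open>A\<close>.\<close>

lemma weights_subordinate_to_cover:
  fixes n :: nat
  assumes Y: "normal_space Y" and A: "closedin Y A"
    and U: "\<And>i. i < n \<Longrightarrow> openin Y (U i)" and AU: "\<And>i. i < n \<Longrightarrow> A \<subseteq> U i"
    and cover: "topspace Y \<subseteq> (\<Union>i<n. U i)"
  obtains t F where
    "\<And>i. i < n \<Longrightarrow> continuous_map Y unit_interval (t i)"
    "\<And>i. i < n \<Longrightarrow> closedin Y (F i)" "\<And>i. i < n \<Longrightarrow> F i \<subseteq> U i"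
    "\<And>i y. i < n \<Longrightarrow> y \<in> topspace Y - F i \<Longrightarrow> t i y = 0"
    "\<And>i y. i < n \<Longrightarrow> y \<in> A \<Longrightarrow> t i y = 1"
    "\<And>y. y \<in> topspace Y \<Longrightarrow> \<exists>i<n. t i y = 1"
proof -
  obtain C where C: "\<And>i. i < n \<Longrightarrow> closedin Y (C i)" "\<And>i. i < n \<Longrightarrow> C i \<subseteq> U i"
    "topspace Y \<subseteq> (\<Union>i<n. C i)"
    by (rule finite_cover_shrink [OF Y closedin_topspace U cover]) (assumption | rule that)+
  define Q where "Q = (\<lambda>i t F. continuous_map Y unit_interval t \<and> closedin Y F \<and> F \<subseteq> U i \<and>
    (\<forall>y\<in>C i \<union> A. t y = 1) \<and> (\<forall>y\<in>topspace Y - F. t y = 0))"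
  have "\<exists>t F. Q i t F" if i: "i < n" for i
  proof -
    have CA: "closedin Y (C i \<union> A)" "C i \<union> A \<subseteq> U i"
      using C(1,2) [OF i] AU [OF i] A by (auto intro: closedin_Un)
    obtain t F where tF: "continuous_map Y unit_interval t" "closedin Y F" "F \<subseteq> U i"
      "\<And>y. y \<in> C i \<union> A \<Longrightarrow> t y = 1" "\<And>y. y \<in> topspace Y - F \<Longrightarrow> t y = 0"
      by (rule Urysohn_supported [OF Y CA(1) U [OF i] CA(2)]) (rule that)
    then have "Q i t F" unfolding Q_def by (intro conjI ballI)
    then show ?thesis by (intro exI)
  qed
  then have "\<forall>i\<in>{..<n}. \<exists>t. \<exists>F. Q i t F" by simp
  from bchoice [OF this] obtain t where "\<forall>i\<in>{..<n}. \<exists>F. Q i (t i) F" by (elim exE)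
  from bchoice [OF this] obtain F where "\<forall>i\<in>{..<n}. Q i (t i) (F i)" by (elim exE)
  then have Q: "Q i (t i) (F i)" if "i < n" for i using that by simp
  show ?thesis
  proof (rule that [of t F])
    show "\<exists>i<n. t i y = 1" if y: "y \<in> topspace Y" for y
    proof -
      obtain i where "i < n" "y \<in> C i" using C(3) y by blast
      then show ?thesis using Q [of i] unfolding Q_def by blast
    qed
  qed (use Q in \<open>simp_all add: Q_def\<close>)
qed

section \<open>Paths and categorical sets\<close>

text \<open>One half of the exponential law. For compact \<open>K\<close> the points \<open>z\<close> with \<open>G (z, t) \<in> V\<close> for all \<open>t \<in> K\<close>
  form an open set, because the projection along a compact factor is a closed map.\<close>

lemma continuous_map_into_path_space:
  assumes G: "continuous_map (prod_topology Z unit_interval) X G"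
  shows "continuous_map Z (path_space X) (\<lambda>z. \<lambda>t\<in>{0..1}. G (z, t))"
proof -
  let ?\<alpha> = "\<lambda>z. \<lambda>t\<in>{0..1::real}. G (z, t)"
  have ps: "?\<alpha> z \<in> path_set X" if z: "z \<in> topspace Z" for z
  proof -
    have "continuous_map unit_interval (prod_topology Z unit_interval) (\<lambda>t. (z, t))"
      using z by (intro continuous_map_pairedI) auto
    from continuous_map_compose [OF this G]
    have "continuous_map unit_interval X (?\<alpha> z)"
      by (rule continuous_map_eq) auto
    then show ?thesis by (simp add: path_set_def pathin_def)
  qed
  show ?thesis
    unfolding path_space_def
  proof (rule continuous_on_generated_topo, goal_cases)
    case (1 N)
    then obtain K V where N: "N = {\<alpha> \<in> path_set X. \<alpha> ` K \<subseteq> V}"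
      and K: "compactin unit_interval K" and V: "openin X V"
      by blast
    have K01: "K \<subseteq> {0..1}" using K compactin_subset_topspace by fastforce
    let ?ZK = "prod_topology Z (subtopology unit_interval K)"
    have "?ZK = subtopology (prod_topology Z unit_interval) (UNIV \<times> K)"
      by (metis subtopology_Times subtopology_UNIV)
    then have "continuous_map ?ZK X G"
      using continuous_map_from_subtopology [OF G] by metis
    then have "closedin ?ZK {y \<in> topspace ?ZK. G y \<in> topspace X - V}"
      using V by (intro closedin_continuous_map_preimage) auto
    moreover have "compact_space (subtopology unit_interval K)"
      using K by (rule compact_space_subtopology)
    ultimately have "closedin Z (fst ` {y \<in> topspace ?ZK. G y \<in> topspace X - V})"
      using Abstract_Topological_Spaces.closed_map_fst [of "subtopology unit_interval K" Z]
      unfolding closed_map_def by blast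
    then have "openin Z (topspace Z - fst ` {y \<in> topspace ?ZK. G y \<in> topspace X - V})"
      by blast
    moreover have "?\<alpha> -` N \<inter> topspace Z = topspace Z - fst ` {y \<in> topspace ?ZK. G y \<in> topspace X - V}"
    proof -
      have GX: "G (z, t) \<in> topspace X" if "z \<in> topspace Z" "t \<in> K" for z t
        using continuous_map_funspace [OF G] that K01 by auto
      have proj: "z \<in> fst ` {y \<in> topspace ?ZK. G y \<in> topspace X - V} \<longleftrightarrow>
          z \<in> topspace Z \<and> (\<exists>t\<in>K. G (z, t) \<notin> V)" for z
      proof -
        have "z \<in> fst ` {y \<in> topspace ?ZK. G y \<in> topspace X - V} \<longleftrightarrow>
            (\<exists>t. (z, t) \<in> topspace ?ZK \<and> G (z, t) \<in> topspace X - V)"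
          by force
        also have "\<dots> \<longleftrightarrow> z \<in> topspace Z \<and> (\<exists>t\<in>K. G (z, t) \<notin> V)"
          using GX K01 by (auto simp: subset_iff)
        finally show ?thesis .
      qed
      have pre: "z \<in> ?\<alpha> -` N \<inter> topspace Z \<longleftrightarrow>
          z \<in> topspace Z \<and> (\<forall>t\<in>K. G (z, t) \<in> V)" for z
        using ps [of z] K01 by (auto simp: N image_subset_iff subset_iff)
      show ?thesis
      proof (rule set_eqI)
        fix z
        show "z \<in> ?\<alpha> -` N \<inter> topspace Z \<longleftrightarrow>
            z \<in> topspace Z - fst ` {y \<in> topspace ?ZK. G y \<in> topspace X - V}"
          unfolding pre Diff_iff [of z "topspace Z"] proj by blast
      qed
    qed
    ultimately show ?case by simp
  next
    case 2
    have "topspace (path_space X) = path_set X" by simp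
    then show ?case using ps unfolding path_space_def topology_generated_by_topspace by blast
  qed
qed

text \<open>The other half of the exponential law, which rests on the local compactness of the interval.\<close>

lemma continuous_map_path_evaluation:
  "continuous_map (prod_topology (path_space X) unit_interval) X (\<lambda>(\<alpha>, t). \<alpha> t)"
  unfolding continuous_map_def
proof (intro conjI allI impI)
  show "(\<lambda>(\<alpha>, t). \<alpha> t) \<in> topspace (prod_topology (path_space X) unit_interval) \<rightarrow> topspace X"
    by (auto simp: path_set_def pathin_def continuous_map_def Pi_iff)
  fix V assume V: "openin X V"
  let ?Y = "prod_topology (path_space X) unit_interval"
  let ?N = "{y \<in> topspace ?Y. (case y of (\<alpha>, t) \<Rightarrow> \<alpha> t) \<in> V}"
  show "openin ?Y ?N"
  proof (subst openin_subopen, clarify)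
    fix \<alpha> and s :: real
    assume as: "(\<alpha>, s) \<in> topspace ?Y" "\<alpha> s \<in> V"
    then have \<alpha>: "\<alpha> \<in> path_set X" and s: "s \<in> {0..1}" by auto
    have "openin unit_interval {r \<in> topspace unit_interval. \<alpha> r \<in> V}"
      using \<alpha> V unfolding path_set_def pathin_def
      by (blast intro: openin_continuous_map_preimage)
    then obtain e where e: "e > 0" "cball s e \<inter> {0..1} \<subseteq> {r \<in> {0..1}. \<alpha> r \<in> V}"
      using s as(2) unfolding openin_contains_cball by auto
    let ?K = "cball s e \<inter> {0..1}"
    let ?A = "{\<beta> \<in> path_set X. \<beta> ` ?K \<subseteq> V}"
    have "compactin unit_interval ?K"
      by (auto simp: compactin_subtopology compact_Int)
    then have "openin (path_space X) ?A"
      unfolding path_space_def using V by (intro topology_generated_by_Basis) blast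
    moreover have "openin unit_interval ({0..1} \<inter> ball s e)"
      by (simp add: openin_open_Int)
    ultimately have "openin ?Y (?A \<times> ({0..1} \<inter> ball s e))"
      by (simp add: openin_prod_Times_iff)
    moreover have "(\<alpha>, s) \<in> ?A \<times> ({0..1} \<inter> ball s e)"
      using \<alpha> s e by auto
    moreover have "?A \<times> ({0..1} \<inter> ball s e) \<subseteq> ?N"
      by (auto simp: image_subset_iff)
    ultimately show "\<exists>T. openin ?Y T \<and> (\<alpha>, s) \<in> T \<and> T \<subseteq> ?N" by blast
  qed
qed

lemma continuous_map_reverse_time:
  "continuous_map (prod_topology Z unit_interval) unit_interval (\<lambda>y. 1 - snd y)"
proof -
  have "continuous_map unit_interval unit_interval (\<lambda>t. 1 - t)"
    by (auto intro: continuous_intros)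
  from continuous_map_compose [OF continuous_map_snd this] show ?thesis
    by (simp add: o_def)
qed

text \<open>A homotopy over the first coordinate that deforms \<open>(x, y)\<close> to the diagonal moves \<open>y\<close> along a path to \<open>x\<close>;
  reversed, it is a path from \<open>x\<close> to \<open>y\<close>. So a categorical set is an open set containing the diagonal over
  which the end-point map has a section that takes the diagonal to constant paths.\<close>

lemma fibrewise_pointed_categorical_iff_paths:
  "fibrewise_pointed_categorical X U \<longleftrightarrow>
     openin (square X) U \<and> diag ` topspace X \<subseteq> U \<and>
     (\<exists>\<alpha>. continuous_map (subtopology (square X) U) (path_space X) \<alpha> \<and>
         (\<forall>z\<in>U. endpoints (\<alpha> z) = z) \<and>
         (\<forall>x\<in>topspace X. \<alpha> (diag x) = const_path x))"
  (is "?L \<longleftrightarrow> ?R")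
proof
  assume ?L
  then obtain H where U: "openin (square X) U" "diag ` topspace X \<subseteq> U"
    and H: "continuous_map (prod_topology (subtopology (square X) U) unit_interval) (square X) H"
    and fst: "\<forall>z\<in>U. \<forall>t\<in>{0..1}. fst (H (z, t)) = fst z"
    and H0: "\<forall>z\<in>U. H (z, 0) = z"
    and Hd: "\<forall>x\<in>topspace X. \<forall>t\<in>{0..1}. H (diag x, t) = diag x"
    and H1: "\<forall>z\<in>U. H (z, 1) \<in> diag ` topspace X"
    unfolding fibrewise_pointed_categorical_def by (elim conjE exE) (rule that)
  let ?Z = "subtopology (square X) U"
  have "continuous_map (prod_topology ?Z unit_interval) (prod_topology ?Z unit_interval)
      (\<lambda>y. (fst y, 1 - snd y))"
    by (intro continuous_map_pairedI continuous_map_fst continuous_map_reverse_time)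
  from continuous_map_compose [OF continuous_map_compose [OF this H] continuous_map_snd]
  have "continuous_map (prod_topology ?Z unit_interval) X (\<lambda>y. snd (H (fst y, 1 - snd y)))"
    by (simp add: o_def case_prod_beta)
  from continuous_map_into_path_space [OF this]
  have "continuous_map ?Z (path_space X) (\<lambda>z. \<lambda>t\<in>{0..1}. snd (H (z, 1 - t)))"
    by simp
  moreover have "endpoints (\<lambda>t\<in>{0..1}. snd (H (z, 1 - t))) = z" if z: "z \<in> U" for z
  proof -
    have "snd (H (z, 1)) = fst z"
      using bspec [OF H1 z] bspec [OF bspec [OF fst z], of 1] by auto
    then show ?thesis using bspec [OF H0 z] by (simp add: endpoints_def)
  qed
  moreover have "(\<lambda>t\<in>{0..1}. snd (H (diag x, 1 - t))) = const_path x" if "x \<in> topspace X" for x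
    using bspec [OF Hd that] unfolding const_path_def by (intro restrict_ext) simp
  ultimately show ?R using U by blast
next
  assume ?R
  then obtain \<alpha> where U: "openin (square X) U" "diag ` topspace X \<subseteq> U"
    and \<alpha>: "continuous_map (subtopology (square X) U) (path_space X) \<alpha>"
    and ends: "\<forall>z\<in>U. endpoints (\<alpha> z) = z"
    and \<alpha>d: "\<forall>x\<in>topspace X. \<alpha> (diag x) = const_path x"
    by blast
  let ?Z = "subtopology (square X) U"
  let ?H = "\<lambda>y. (fst (fst y), \<alpha> (fst y) (1 - snd y))"
  have 1: "continuous_map (prod_topology ?Z unit_interval) (prod_topology (path_space X) unit_interval)
      (\<lambda>y. (\<alpha> (fst y), 1 - snd y))"
    by (intro continuous_map_pairedI continuous_map_reverse_time
        continuous_map_compose [OF continuous_map_fst \<alpha>, unfolded o_def])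
  have 2: "continuous_map (prod_topology ?Z unit_interval) X (\<lambda>y. fst (fst y))"
    by (intro continuous_map_compose [OF continuous_map_fst, unfolded o_def]
        continuous_map_from_subtopology continuous_map_fst)
  have "continuous_map (prod_topology ?Z unit_interval) (square X) ?H"
    using continuous_map_pairedI [OF 2 continuous_map_compose [OF 1 continuous_map_path_evaluation]]
    by (simp add: o_def case_prod_beta)
  moreover have "\<alpha> z 0 = fst z" "\<alpha> z 1 = snd z" if "z \<in> U" for z
    using bspec [OF ends that] by (auto simp: endpoints_def prod_eq_iff)
  moreover have "fst z \<in> topspace X" if "z \<in> U" for z
    using openin_subset [OF U(1)] that by auto
  moreover have "?H (diag x, t) = diag x" if "x \<in> topspace X" "t \<in> {0..1}" for x t
    using \<alpha>d that by (simp add: const_path_def)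
  ultimately show ?L
    unfolding fibrewise_pointed_categorical_def using U
    by (intro conjI exI [where x = ?H]) simp_all
qed

section \<open>Coordinates of fibrewise joins\<close>

text \<open>Coordinates of a point of the join, read off from an arbitrary representative. The weight does not
  depend on the representative, and the entry does not where the weight is non-zero.\<close>

definition join_weight :: "nat \<Rightarrow> (nat \<Rightarrow> 'e \<times> real) set \<Rightarrow> real"
  where "join_weight i c = snd ((SOME w. w \<in> c) i)"

definition join_entry :: "nat \<Rightarrow> (nat \<Rightarrow> 'e \<times> real) set \<Rightarrow> 'e"
  where "join_entry i c = fst ((SOME w. w \<in> c) i)"

lemma join_coordinates_join_class:
  assumes w: "w \<in> topspace (prejoin n E p)" and i: "i < n"
  shows "join_weight i (join_class n E p w) = snd (w i)"
    and "snd (w i) \<noteq> 0 \<Longrightarrow> join_entry i (join_class n E p w) = fst (w i)"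
proof -
  define v where "v = (SOME v. v \<in> join_class n E p w)"
  have "w \<in> join_class n E p w"
    unfolding join_class_def using equiv_class_self [OF equiv_join_rel w] .
  then have "v \<in> join_class n E p w"
    unfolding v_def by (rule someI [where P = "\<lambda>v. v \<in> join_class n E p w"])
  then have v: "snd (w i) = snd (v i)" "snd (w i) \<noteq> 0 \<Longrightarrow> fst (w i) = fst (v i)"
    using i by (simp_all add: join_class_def join_rel_def)
  show "join_weight i (join_class n E p w) = snd (w i)"
    unfolding join_weight_def v(1) v_def ..
  show "join_entry i (join_class n E p w) = fst (w i)" if "snd (w i) \<noteq> 0"
    unfolding join_entry_def v(2) [OF that] v_def ..
qed

lemma topspace_fibrewise_join:
  "topspace (fibrewise_join n E p) = join_class n E p ` topspace (prejoin n E p)"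
  by (simp add: fibrewise_join_def)

lemma quotient_map_join_class:
  "quotient_map (prejoin n E p) (fibrewise_join n E p) (join_class n E p)"
  unfolding fibrewise_join_def by (rule quotient_map_quotient_topology)

lemma continuous_map_prejoin_projection:
  assumes "i < n"
  shows "continuous_map (prejoin n E p) (prod_topology (E i) unit_interval) (\<lambda>w. w i)"
  unfolding prejoin_def using assms
  by (intro continuous_map_from_subtopology continuous_map_product_projection) auto

lemma continuous_map_join_weight:
  assumes "i < n"
  shows "continuous_map (fibrewise_join n E p) unit_interval (join_weight i)"
proof (rule continuous_compose_quotient_map [OF quotient_map_join_class])
  have "continuous_map (prejoin n E p) unit_interval (snd \<circ> (\<lambda>w. w i))"
    by (rule continuous_map_compose [OF continuous_map_prejoin_projection [OF assms] continuous_map_snd])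
  then show "continuous_map (prejoin n E p) unit_interval (join_weight i \<circ> join_class n E p)"
    by (rule continuous_map_eq) (simp add: join_coordinates_join_class(1) [OF _ assms])
qed

lemma openin_join_weight_nonzero:
  assumes "i < n"
  shows "openin (fibrewise_join n E p) {c \<in> topspace (fibrewise_join n E p). join_weight i c \<noteq> 0}"
proof -
  have "openin unit_interval ({0..1} \<inter> - {0})"
    by (rule openin_open_Int) auto
  from openin_continuous_map_preimage [OF continuous_map_join_weight [OF assms] this, of E p]
  have "openin (fibrewise_join n E p)
      {c \<in> topspace (fibrewise_join n E p). join_weight i c \<in> {0..1} \<inter> - {0}}" .
  moreover have "join_weight i c \<in> {0..1}" if "c \<in> topspace (fibrewise_join n E p)" for c
    using continuous_map_funspace [OF continuous_map_join_weight [OF assms], of E p] that by auto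
  then have "{c \<in> topspace (fibrewise_join n E p). join_weight i c \<in> {0..1} \<inter> - {0}}
      = {c \<in> topspace (fibrewise_join n E p). join_weight i c \<noteq> 0}"
    by blast
  ultimately show ?thesis by simp
qed

text \<open>The region of non-zero weight is open, so the quotient map onto the join restricts to a quotient map
  over it, and there the entry is well defined on classes.\<close>

lemma continuous_map_join_entry:
  assumes "i < n"
  shows "continuous_map
    (subtopology (fibrewise_join n E p) {c \<in> topspace (fibrewise_join n E p). join_weight i c \<noteq> 0})
    (E i) (join_entry i)"
proof -
  let ?V = "{c \<in> topspace (fibrewise_join n E p). join_weight i c \<noteq> 0}"
  let ?W = "{w \<in> topspace (prejoin n E p). snd (w i) \<noteq> 0}"
  have W: "{w \<in> topspace (prejoin n E p). join_class n E p w \<in> ?V} = ?W"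
  proof (rule Collect_cong)
    fix w
    show "w \<in> topspace (prejoin n E p) \<and> join_class n E p w \<in> ?V \<longleftrightarrow>
        w \<in> topspace (prejoin n E p) \<and> snd (w i) \<noteq> 0"
    proof (cases "w \<in> topspace (prejoin n E p)")
      case True
      then have "join_class n E p w \<in> topspace (fibrewise_join n E p)"
        unfolding topspace_fibrewise_join by (rule imageI)
      then show ?thesis
        using True join_coordinates_join_class(1) [OF True assms] by simp
    qed simp
  qed
  have "quotient_map (subtopology (prejoin n E p) ?W) (subtopology (fibrewise_join n E p) ?V)
      (join_class n E p)"
    by (rule quotient_map_restriction [OF quotient_map_join_class W])
       (use openin_join_weight_nonzero [OF assms] in blast)
  then show ?thesis
  proof (rule continuous_compose_quotient_map)
    have "continuous_map (prejoin n E p) (E i) (\<lambda>w. fst (w i))"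
      using continuous_map_compose [OF continuous_map_prejoin_projection [OF assms] continuous_map_fst]
      by (simp add: o_def)
    then show "continuous_map (subtopology (prejoin n E p) ?W) (E i) (join_entry i \<circ> join_class n E p)"
      by (intro continuous_map_eq [OF continuous_map_from_subtopology])
         (auto simp: join_coordinates_join_class(2) [OF _ assms])
  qed
qed

lemma join_proj_join_entry:
  assumes "c \<in> topspace (fibrewise_join n E p)" "i < n" "join_weight i c \<noteq> 0"
  shows "p i (join_entry i c) = join_proj n p c"
proof -
  obtain w where w: "w \<in> topspace (prejoin n E p)" "c = join_class n E p w"
    using assms(1) by (auto simp: topspace_fibrewise_join)
  then show ?thesis
    using join_coordinates_join_class [OF w(1) assms(2)] assms(3)
      join_proj_join_class [OF w(1) assms(2)] by simp
qed

lemma join_weight_attains_1: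
  assumes "c \<in> topspace (fibrewise_join n E p)"
  obtains i where "i < n" "join_weight i c = 1"
proof -
  obtain w where w: "w \<in> topspace (prejoin n E p)" "c = join_class n E p w"
    using assms by (auto simp: topspace_fibrewise_join)
  then obtain i where "i < n" "snd (w i) = 1"
    unfolding topspace_prejoin by blast
  then show ?thesis
    using that join_coordinates_join_class(1) [OF w(1)] w(2) by metis
qed

lemma join_class_eqI:
  assumes "w \<in> topspace (prejoin n E p)" "w' \<in> topspace (prejoin n E p)"
    and "\<And>i. i < n \<Longrightarrow> snd (w i) = snd (w' i)"
    and "\<And>i. i < n \<Longrightarrow> snd (w i) \<noteq> 0 \<Longrightarrow> fst (w i) = fst (w' i)"
  shows "join_class n E p w = join_class n E p w'"
  unfolding join_class_def
  by (rule equiv_class_eq [OF equiv_join_rel]) (use assms in \<open>auto simp: join_rel_def\<close>)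

text \<open>The tuple \<open>w\<close> stands for the point \<open>[e 0, t 0, e 1, t 1, \<dots>]\<close>. The entries of \<open>e\<close> with weight 0 may be
  arbitrary, even outside the total spaces; those of \<open>w\<close> may not.\<close>

definition represents_join_point ::
    "nat \<Rightarrow> (nat \<Rightarrow> 'e topology) \<Rightarrow> (nat \<Rightarrow> 'e \<Rightarrow> 'b) \<Rightarrow>
     (nat \<Rightarrow> 'e) \<Rightarrow> (nat \<Rightarrow> real) \<Rightarrow> (nat \<Rightarrow> 'e \<times> real) \<Rightarrow> bool"
  where "represents_join_point n E p e t w \<longleftrightarrow> w \<in> topspace (prejoin n E p) \<and>
    (\<forall>i<n. snd (w i) = t i \<and> (t i \<noteq> 0 \<longrightarrow> fst (w i) = e i))"

lemma join_class_represents: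
  assumes "represents_join_point n E p e t w" "represents_join_point n E p e t w'"
  shows "join_class n E p w = join_class n E p w'"
  using assms unfolding represents_join_point_def
  by (intro join_class_eqI) auto

text \<open>Partial sections with weights combine to a map into the join. Before identification there is in
  general no continuous choice of a tuple, since the section \<open>e i\<close> does not extend beyond \<open>U i\<close>. Near a
  fixed point, however, the weights of all sections that are not defined around it vanish; their
  entries can be replaced there by those of one section that is defined. The class does not see
  the replacement, so the local lifts agree after identification.\<close>

lemma map_into_fibrewise_join:
  fixes E :: "'e topology" and p :: "'e \<Rightarrow> 'b" and b :: "'y \<Rightarrow> 'b" and e :: "nat \<Rightarrow> 'y \<Rightarrow> 'e"
  assumes U: "\<And>i. i < n \<Longrightarrow> openin Y (U i)"
    and F: "\<And>i. i < n \<Longrightarrow> closedin Y (F i)" and FU: "\<And>i. i < n \<Longrightarrow> F i \<subseteq> U i"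
    and e: "\<And>i. i < n \<Longrightarrow> continuous_map (subtopology Y (U i)) E (e i)"
    and p: "\<And>i y. i < n \<Longrightarrow> y \<in> U i \<Longrightarrow> p (e i y) = b y"
    and t: "\<And>i. i < n \<Longrightarrow> continuous_map Y unit_interval (t i)"
    and t0: "\<And>i y. i < n \<Longrightarrow> y \<in> topspace Y - F i \<Longrightarrow> t i y = 0"
    and t1: "\<And>y. y \<in> topspace Y \<Longrightarrow> \<exists>i<n. t i y = 1"
  obtains s where "continuous_map Y (fibrewise_join n (\<lambda>_. E) (\<lambda>_. p)) s"
    and "\<And>y. y \<in> topspace Y \<Longrightarrow> join_proj n (\<lambda>_. p) (s y) = b y"
    and "\<And>y w. represents_join_point n (\<lambda>_. E) (\<lambda>_. p) (\<lambda>i. e i y) (\<lambda>i. t i y) w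
           \<Longrightarrow> s y = join_class n (\<lambda>_. E) (\<lambda>_. p) w"
proof -
  let ?P = "prejoin n (\<lambda>_. E) (\<lambda>_. p)"
  let ?q = "join_class n (\<lambda>_. E) (\<lambda>_. p)"
  define R where "R = (\<lambda>y. represents_join_point n (\<lambda>_. E) (\<lambda>_. p) (\<lambda>i. e i y) (\<lambda>i. t i y))"
  \<comment> \<open>The chosen representative need not depend continuously on \<open>y\<close>; its class does.\<close>
  define s where "s = (\<lambda>y. ?q (SOME w. R y w))"
  have s: "s y = ?q w" if "R y w" for y w
    using someI [of "R y", OF that] that join_class_represents
    unfolding s_def R_def by blast
  define L where "L = (\<lambda>x W v. openin Y W \<and> x \<in> W \<and> continuous_map (subtopology Y W) ?P v \<and>
      (\<forall>y\<in>W. R y (v y)) \<and> (\<forall>y\<in>W. \<forall>i<n. p (fst (v y i)) = b y))"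
  have local_lift: "\<exists>W v. L x W v"
    if x: "x \<in> topspace Y" for x
  proof -
    obtain k where k: "k < n" "t k x = 1"
      using t1 [OF x] by blast
    \<comment> \<open>Only the sections in \<open>S\<close> can have non-zero weight near \<open>x\<close>. The \<open>k\<close>-th one, with weight 1 at
      \<open>x\<close>, is defined around \<open>x\<close> and substitutes for all others.\<close>
    define S where "S = {i. i < n \<and> x \<in> F i}"
    define W where "W = topspace Y \<inter> (\<Inter>i\<in>S. U i) \<inter> (\<Inter>i\<in>{..<n} - S. topspace Y - F i)"
    define r where "r = (\<lambda>i. if i \<in> S then i else k)"
    define v where "v = (\<lambda>y. \<lambda>i\<in>{..<n}. (e (r i) y, t i y))"
    have kS: "k \<in> S"
      using t0 [OF k(1)] k x by (force simp: S_def)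
    have r: "r i < n" "r i \<in> S" for i
      using kS by (auto simp: r_def S_def)
    have WU: "W \<subseteq> U (r i)" for i
      using r(2) by (auto simp: W_def)
    have W: "openin Y W"
    proof -
      have "W = \<Inter>(insert (topspace Y) (U ` S \<union> (\<lambda>i. topspace Y - F i) ` ({..<n} - S)))"
        by (auto simp: W_def)
      also have "openin Y \<dots>"
        by (rule openin_Inter) (use U F in \<open>auto simp: S_def\<close>)
      finally show ?thesis .
    qed
    have xW: "x \<in> W"
      using x FU by (auto simp: W_def S_def)
    have WY: "W \<subseteq> topspace Y" by (auto simp: W_def)
    have pv: "p (fst (v y i)) = b y" if "y \<in> W" "i < n" for y i
      using p [OF r(1)] WU that by (auto simp: v_def)
    have "continuous_map (subtopology Y W) (product_topology (\<lambda>i. prod_topology E unit_interval) {..<n}) v"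
      unfolding continuous_map_componentwise
    proof (intro conjI ballI)
      show "v ` topspace (subtopology Y W) \<subseteq> extensional {..<n}"
        by (auto simp: v_def)
      fix i assume i: "i \<in> {..<n}"
      have "continuous_map (subtopology Y W) E (e (r i))"
        using e [OF r(1)] WU by (rule continuous_map_from_subtopology_mono)
      moreover have "continuous_map (subtopology Y W) unit_interval (t i)"
        using t i by (intro continuous_map_from_subtopology) auto
      ultimately show "continuous_map (subtopology Y W) (prod_topology E unit_interval) (\<lambda>y. v y i)"
        using i by (simp add: v_def continuous_map_pairedI)
    qed
    moreover have "v ` topspace (subtopology Y W) \<subseteq>
        {w. (\<forall>i<n. \<forall>j<n. p (fst (w i)) = p (fst (w j))) \<and> (\<exists>i<n. snd (w i) = 1)}"
    proof clarify
      fix y assume "y \<in> topspace (subtopology Y W)"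
      then have y: "y \<in> W" "y \<in> topspace Y" by auto
      have "\<exists>i<n. snd (v y i) = 1"
        using t1 [OF y(2)] by (auto simp: v_def)
      then show "(\<forall>i<n. \<forall>j<n. p (fst (v y i)) = p (fst (v y j))) \<and> (\<exists>i<n. snd (v y i) = 1)"
        using pv y by simp
    qed
    ultimately have v: "continuous_map (subtopology Y W) ?P v"
      unfolding prejoin_def continuous_map_in_subtopology by blast
    have "\<forall>y\<in>W. R y (v y)"
    proof
      fix y assume y: "y \<in> W"
      then have yY: "y \<in> topspace Y" using WY by blast
      have "v y \<in> topspace ?P"
        using continuous_map_funspace [OF v] y yY by auto
      moreover have "r i = i" if "i < n" "t i y \<noteq> 0" for i
      proof -
        have "y \<in> F i" using t0 [OF that(1)] that(2) yY by blast
        then have "i \<in> S" using that(1) y unfolding W_def by blast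
        then show ?thesis by (simp add: r_def)
      qed
      ultimately show "R y (v y)"
        unfolding R_def represents_join_point_def by (simp add: v_def)
    qed
    moreover have "\<forall>y\<in>W. \<forall>i<n. p (fst (v y i)) = b y"
      using pv by simp
    ultimately have "L x W v"
      unfolding L_def using W xW v by (intro conjI)
    then show ?thesis by (intro exI)
  qed
  then have "\<forall>x\<in>topspace Y. \<exists>W. \<exists>v. L x W v" by (intro ballI)
  from bchoice [OF this] obtain W where "\<forall>x\<in>topspace Y. \<exists>v. L x (W x) v" by (elim exE)
  from bchoice [OF this] obtain v where "\<forall>x\<in>topspace Y. L x (W x) (v x)" by (elim exE)
  then have L: "L x (W x) (v x)" if "x \<in> topspace Y" for x
    using that by (rule bspec)
  have W: "openin Y (W x)" and xW: "x \<in> W x"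
    and v: "continuous_map (subtopology Y (W x)) ?P (v x)"
    if "x \<in> topspace Y" for x
    using L [OF that] unfolding L_def by simp_all
  have R: "R y (v x y)" if "x \<in> topspace Y" "y \<in> W x" for x y
    using L [OF that(1)] that(2) unfolding L_def by simp
  have pv: "p (fst (v x y i)) = b y" if "x \<in> topspace Y" "y \<in> W x" "i < n" for x y i
    using L [OF that(1)] that(2,3) unfolding L_def by simp
  show ?thesis
  proof (rule that)
    show "continuous_map Y (fibrewise_join n (\<lambda>_. E) (\<lambda>_. p)) s"
    proof (rule pasting_lemma [where I = "topspace Y" and T = W and f = "\<lambda>_. s"])
      fix x assume x: "x \<in> topspace Y"
      have "continuous_map (subtopology Y (W x)) (fibrewise_join n (\<lambda>_. E) (\<lambda>_. p)) (?q \<circ> v x)"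
        by (rule continuous_map_compose [OF v [OF x]
              quotient_imp_continuous_map [OF quotient_map_join_class]])
      then show "continuous_map (subtopology Y (W x)) (fibrewise_join n (\<lambda>_. E) (\<lambda>_. p)) s"
        by (rule continuous_map_eq) (use s R [OF x] in auto)
    qed (use W xW in auto)
    show "join_proj n (\<lambda>_. p) (s y) = b y" if y: "y \<in> topspace Y" for y
    proof -
      obtain i where i: "i < n" using t1 [OF y] by blast
      have Ry: "R y (v y y)" using R [OF y xW [OF y]] .
      then have "v y y \<in> topspace ?P"
        unfolding R_def represents_join_point_def by blast
      from join_proj_join_class [OF this i] show ?thesis
        using pv [OF y xW [OF y] i] s [OF Ry] by simp
    qed
    show "s y = ?q w"
      if "represents_join_point n (\<lambda>_. E) (\<lambda>_. p) (\<lambda>i. e i y) (\<lambda>i. t i y) w" for y w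
      using s that unfolding R_def by blast
  qed
qed

section \<open>Categorical covers and sections of the fibrewise Ganea space\<close>

text \<open>The sets of the cover are the regions where the weights of \<open>s\<close> are non-zero; the entries of \<open>s\<close> provide
  the paths over them. They contain the diagonal, and the paths there are constant, because \<open>s\<close>
  takes \<open>(x, x)\<close> to the class of constant paths with all weights equal to 1.\<close>

lemma cover_of_ganea_section:
  assumes s: "ganea_section X n s"
  shows "\<exists>U. (\<forall>i<n. fibrewise_pointed_categorical X (U i)) \<and> (\<Union>i<n. U i) = topspace (square X)"
proof -
  let ?J = "fibrewise_join n (\<lambda>_. path_space X) (\<lambda>_. endpoints)"
  define U where "U = (\<lambda>i. {z \<in> topspace (square X). join_weight i (s z) \<noteq> 0})"
  have cont: "continuous_map (square X) ?J s"
    and sd: "\<And>x. x \<in> topspace X \<Longrightarrow> s (diag x) = ganea_point X n x"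
    using s unfolding ganea_section_def fibrewise_pointed_map_def
    by (simp_all add: fibrewise_square_def fibrewise_ganea_def)
  have proj: "ganea_proj n (s z) = z" if "z \<in> topspace (square X)" for z
    using s that unfolding ganea_section_def by blast
  have sJ: "s z \<in> topspace ?J" if "z \<in> topspace (square X)" for z
    using continuous_map_funspace [OF cont] that by blast
  have "fibrewise_pointed_categorical X (U i)" if i: "i < n" for i
  proof -
    let ?O = "{c \<in> topspace ?J. join_weight i c \<noteq> 0}"
    have "{z \<in> topspace (square X). s z \<in> ?O} = U i"
      unfolding U_def using sJ by blast
    then have "openin (square X) (U i)"
      using openin_continuous_map_preimage [OF cont openin_join_weight_nonzero [OF i]] by simp
    moreover have base: "join_weight i (s (diag x)) = 1" "join_entry i (s (diag x)) = const_path x"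
      if "x \<in> topspace X" for x
      using join_coordinates_join_class [OF ganea_basepoint [OF _ that] i] i
      by (simp_all add: sd [OF that] ganea_point_def)
    then have "diag ` topspace X \<subseteq> U i"
      by (auto simp: U_def)
    moreover have "continuous_map (subtopology (square X) (U i)) (subtopology ?J ?O) s"
      unfolding continuous_map_in_subtopology
      using sJ by (auto simp: U_def intro: continuous_map_from_subtopology [OF cont])
    then have "continuous_map (subtopology (square X) (U i)) (path_space X) (join_entry i \<circ> s)"
      by (rule continuous_map_compose [OF _ continuous_map_join_entry [OF i]])
    moreover have "endpoints ((join_entry i \<circ> s) z) = z" if "z \<in> U i" for z
    proof -
      have z: "z \<in> topspace (square X)" "join_weight i (s z) \<noteq> 0"
        using that unfolding U_def by blast+
      show ?thesis
        using join_proj_join_entry [OF sJ [OF z(1)] i z(2)] proj [OF z(1)]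
        by (simp add: ganea_proj_def)
    qed
    ultimately show ?thesis
      unfolding fibrewise_pointed_categorical_iff_paths using base(2)
      by (intro conjI exI [where x = "join_entry i \<circ> s"]) simp_all
  qed
  moreover have "(\<Union>i<n. U i) = topspace (square X)"
  proof
    show "topspace (square X) \<subseteq> (\<Union>i<n. U i)"
    proof
      fix z assume z: "z \<in> topspace (square X)"
      obtain i where i: "i < n" "join_weight i (s z) = 1"
        by (rule join_weight_attains_1 [OF sJ [OF z]])
      then have "z \<in> U i" unfolding U_def using z by simp
      with i(1) show "z \<in> (\<Union>i<n. U i)" by blast
    qed
  qed (auto simp: U_def)
  ultimately show ?thesis by blast
qed

text \<open>To respect the base points, the section must have all weights equal to 1 on the diagonal. This is
  possible because the diagonal is closed and contained in each set of the cover.\<close>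

lemma ganea_section_of_cover:
  assumes normal: "normal_space (square X)"
    and closed: "closedin (square X) (diag ` topspace X)"
    and U: "\<And>i. i < n \<Longrightarrow> fibrewise_pointed_categorical X (U i)"
    and cover: "(\<Union>i<n. U i) = topspace (square X)"
  shows "\<exists>s. ganea_section X n s"
proof -
  let ?J = "fibrewise_join n (\<lambda>_. path_space X) (\<lambda>_. endpoints)"
  let ?q = "join_class n (\<lambda>_. path_space X) (\<lambda>_. endpoints)"
  have opU: "openin (square X) (U i)" and diagU: "diag ` topspace X \<subseteq> U i" if "i < n" for i
    using U [OF that] unfolding fibrewise_pointed_categorical_iff_paths by blast+
  have "\<forall>i\<in>{..<n}. \<exists>\<alpha>. continuous_map (subtopology (square X) (U i)) (path_space X) \<alpha> \<and>
      (\<forall>z\<in>U i. endpoints (\<alpha> z) = z) \<and> (\<forall>x\<in>topspace X. \<alpha> (diag x) = const_path x)"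
    using U unfolding fibrewise_pointed_categorical_iff_paths by simp
  from bchoice [OF this] obtain \<alpha> where
    "\<forall>i\<in>{..<n}. continuous_map (subtopology (square X) (U i)) (path_space X) (\<alpha> i) \<and>
      (\<forall>z\<in>U i. endpoints (\<alpha> i z) = z) \<and> (\<forall>x\<in>topspace X. \<alpha> i (diag x) = const_path x)"
    by (elim exE)
  then have \<alpha>: "i < n \<Longrightarrow> continuous_map (subtopology (square X) (U i)) (path_space X) (\<alpha> i)"
      "i < n \<Longrightarrow> z \<in> U i \<Longrightarrow> endpoints (\<alpha> i z) = z"
      "i < n \<Longrightarrow> x \<in> topspace X \<Longrightarrow> \<alpha> i (diag x) = const_path x" for i z x
    by simp_all
  obtain t F where
    t: "\<And>i. i < n \<Longrightarrow> continuous_map (square X) unit_interval (t i)"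
    and F: "\<And>i. i < n \<Longrightarrow> closedin (square X) (F i)" and FU: "\<And>i. i < n \<Longrightarrow> F i \<subseteq> U i"
    and t0: "\<And>i z. i < n \<Longrightarrow> z \<in> topspace (square X) - F i \<Longrightarrow> t i z = 0"
    and td: "\<And>i z. i < n \<Longrightarrow> z \<in> diag ` topspace X \<Longrightarrow> t i z = 1"
    and t1: "\<And>z. z \<in> topspace (square X) \<Longrightarrow> \<exists>i<n. t i z = 1"
    by (rule weights_subordinate_to_cover [OF normal closed opU diagU equalityD2 [OF cover]])
       (assumption | rule that)+
  obtain s where s: "continuous_map (square X) ?J s"
    and proj: "\<And>z. z \<in> topspace (square X) \<Longrightarrow> join_proj n (\<lambda>_. endpoints) (s z) = z"
    and rep: "\<And>z w. represents_join_point n (\<lambda>_. path_space X) (\<lambda>_. endpoints) (\<lambda>i. \<alpha> i z) (\<lambda>i. t i z) w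
           \<Longrightarrow> s z = ?q w"
    by (rule map_into_fibrewise_join
        [where p = endpoints and b = "\<lambda>z. z", OF opU F FU \<alpha>(1,2) t t0 t1])
       (assumption | rule that)+
  have sd: "s (diag x) = ganea_point X n x" if x: "x \<in> topspace X" for x
    unfolding ganea_point_def
  proof (rule rep)
    have n: "0 < n"
      using cover x by (cases n) auto
    have "t i (diag x) = 1" "\<alpha> i (diag x) = const_path x" if "i < n" for i
      using td \<alpha>(3) x that by simp_all
    then show "represents_join_point n (\<lambda>_. path_space X) (\<lambda>_. endpoints)
        (\<lambda>i. \<alpha> i (diag x)) (\<lambda>i. t i (diag x)) (\<lambda>i\<in>{..<n}. (const_path x, 1))"
      unfolding represents_join_point_def using ganea_basepoint [OF n x] by simp
  qed
  \<comment> \<open>The case \<open>n = 0\<close> is degenerate: the join of no spaces is empty, and so is \<open>X\<close>, since no sets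
    cover its square.\<close>
  have "fibrewise_pointed_space X (fibrewise_ganea X n)"
  proof (cases "n = 0")
    case True
    then have "topspace (square X) = {}" using cover by simp
    then have "topspace X = {}" by simp
    then have X: "X = trivial_topology" by simp
    have "topspace ?J = {}"
      unfolding topspace_fibrewise_join topspace_prejoin using True by simp
    then have "?J = trivial_topology" by simp
    then show ?thesis
      by (simp add: X fibrewise_pointed_space_def fibrewise_ganea_def)
  qed (simp add: fibrewise_pointed_space_ganea)
  then have "ganea_section X n s"
    unfolding ganea_section_def fibrewise_pointed_map_def
    using fibrewise_pointed_space_square [of X] s proj sd
    by (simp add: fibrewise_square_def fibrewise_ganea_def ganea_proj_def)
  then show ?thesis by (intro exI)
qed

lemma NDR_pair_imp_closedin:
  assumes "NDR_pair Y A"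
  shows "closedin Y A"
proof -
  obtain u where u: "continuous_map Y unit_interval u" "A = {y \<in> topspace Y. u y = 0}"
    using assms unfolding NDR_pair_def by blast
  have "closedin unit_interval {0}"
    by (simp add: closedin_subtopology_refl closed_subset)
  from closedin_continuous_map_preimage [OF u(1) this] show ?thesis
    by (simp add: u(2))
qed

theorem corollary6:
  fixes X :: "'a topology" and K :: "'v set set"
  assumes "abstract_simplicial_complex K"
    and "square X homeomorphic_space geometric_realization K"
    and "NDR_pair (square X) (diag ` topspace X)"
    and "\<exists>U. fibrewise_pointed_categorical X U"
  shows "monoidal_TC X = (INF n \<in> {n. \<exists>s. ganea_section X n s}. enat n)"
proof -
  have normal: "normal_space (square X)"
    using normal_space_geometric_realization [OF assms(1)] homeomorphic_normal_space [OF assms(2)]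
    by blast
  have closed: "closedin (square X) (diag ` topspace X)"
    using assms(3) by (rule NDR_pair_imp_closedin)
  have "(\<exists>U. (\<forall>i<n. fibrewise_pointed_categorical X (U i)) \<and> (\<Union>i<n. U i) = topspace (square X))
      \<longleftrightarrow> (\<exists>s. ganea_section X n s)" for n
  proof
    assume "\<exists>U. (\<forall>i<n. fibrewise_pointed_categorical X (U i)) \<and> (\<Union>i<n. U i) = topspace (square X)"
    then obtain U where "\<And>i. i < n \<Longrightarrow> fibrewise_pointed_categorical X (U i)"
      and "(\<Union>i<n. U i) = topspace (square X)"
      by blast
    then show "\<exists>s. ganea_section X n s"
      by (rule ganea_section_of_cover [OF normal closed])
  qed (elim exE, rule cover_of_ganea_section)
  then show ?thesis
    unfolding monoidal_TC_def by simp
qed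

end
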